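(* Let $G\subset \mathrm{PGL}(2,\mathbb Z)$ be a finite index subgroup, ${\mathbb P}=\mathrm{PGL}(2,\mathbb Z)/G$, and let $t_0\in{\mathbb P}$ be the base point. Fix $c\in\mathbb R$. Then for every $\beta\in L_c=\{\beta\in[0,1] : \lambda(\beta)=c\}$, the limiting modular symbol is given by the limit $$\{\{*,\beta\}\}_G=\lim_{n\to\infty}\frac{1}{c\,n}\sum_{k=1}^n \varphi\big(T^k(t_0)\big),$$ where $\varphi(T^k(t_0))$ denotes $\varphi$ applied to the ${\mathbb P}$-component of $T^k(\beta,t_0)$.
   Context: ${\mathbb P}=\mathrm{PGL}(2,\mathbb Z)/G$ is the finite coset space, with $\mathrm{PGL}(2,\mathbb Z)$ acting by left multiplication; $t_0$ is the coset of the identity. The modular curve is $X_G=G\backslash\mathbb H$ (equivalently $\mathrm{PGL}(2,\mathbb Z)\backslash(\mathbb H\times{\mathbb P})$), $\overline{X_G}$ its compactification by the cusps $G\backslash\mathbb P^1(\mathbb Q)$, and $\phi:\mathbb H\to X_G$ the quotient map. For $\alpha,\beta\in\mathbb H\cup\mathbb P^1(\mathbb Q)$, the modular symbol $\{\alpha,\beta\}_G$ is the real homology class (in $H_1(\overline{X_G},\mathbb R)$, resp. homology relative to the cusps) defined by $\int_{\{\alpha,\beta\}_G}\omega=\int_\alpha^\beta\phi^*\omega$ for holomorphic differentials $\omega$, the integral taken along the hyperbolic geodesic arc from $\alpha$ to $\beta$. For irrational $\beta$, let $\gamma_\beta$ be the geodesic in $\mathbb H$ from $i\infty$ to $\beta$,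 $x_0\in\gamma_\beta$ a base point and $y(\tau)$ the point of $\gamma_\beta$ at hyperbolic distance $\tau$ from $x_0$ in the direction of $\beta$; the limiting modular symbol is $\{\{*,\beta\}\}_G:=\lim_{\tau\to\infty}\frac1\tau\{x_0,y(\tau)\}_G\in H_1(X_G,\mathbb R)$ (independent of choices). The shift is $T:[0,1]\times{\mathbb P}\to[0,1]\times{\mathbb P}$, $T(\beta,t)=\big(\tfrac1\beta-[\tfrac1\beta],\begin{pmatrix}-[1/\beta]&1\\1&0\end{pmatrix}\cdot t\big)$. The function $\varphi:{\mathbb P}\to H_1(\overline{X_G},\text{cusps},\mathbb R)$ is $\varphi(s)=\{g(0),g(i\infty)\}_G$ for $g\in\mathrm{PSL}(2,\mathbb Z)$ a representative of $s$. The Lyapunov exponent of the Gauss map $\beta\mapsto 1/\beta-[1/\beta]$ is $\lambda(\beta)=\lim_{n\to\infty}\frac1n\log|(T^n)'(\beta)|=2\lim_{n\to\infty}\frac1n\log q_n(\beta)$, with $q_n(\beta)$ the denominators of the continued fraction convergents of $\beta$.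
   Formalization: φ(gG) is taken as {g⁻¹(i∞), g⁻¹(0)}_G with g in PGL(2,ℤ), as the printed {g(0), g(i∞)}_G is ill-defined on left cosets and has the wrong sign; classes are real periods (Klein-surface differentials if G has det −1); the equation means one limit exists and is v iff the other does. *)

theory Defs
  imports "HOL-Complex_Analysis.Complex_Analysis" "HOL-Algebra.Left_Coset"
begin

section \<open>The group \<open>PGL(2,\<int>)\<close>\<close>

definition mat2 :: "int \<Rightarrow> int \<Rightarrow> int \<Rightarrow> int \<Rightarrow> int^2^2" where
  "mat2 a b c d = vector [vector [a, b], vector [c, d]]"

definition GL2Z :: "(int^2^2) monoid" where
  "GL2Z = \<lparr>carrier = {A. det A = 1 \<or> det A = -1}, mult = (**), one = mat 1\<rparr>"

definition PGL2Z :: "(int^2^2) set monoid" where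
  "PGL2Z = GL2Z Mod {mat 1, - mat 1}"

definition pgl :: "int^2^2 \<Rightarrow> (int^2^2) set" where
  "pgl A = {mat 1, - mat 1} #>\<^bsub>GL2Z\<^esub> A"

section \<open>Action on the upper half plane and on the cusps\<close>

definition upper_half_plane :: "complex set" where
  "upper_half_plane = {z. Im z > 0}"

datatype ext_point = Infty | Fin complex

fun moebius_point :: "int^2^2 \<Rightarrow> ext_point \<Rightarrow> ext_point" where
  "moebius_point A Infty =
     (if A$2$1 = 0 then Infty else Fin (of_int (A$1$1) / of_int (A$2$1)))"
| "moebius_point A (Fin z) =
     (if of_int (A$2$1) * z + of_int (A$2$2) = 0 then Infty
      else Fin ((of_int (A$1$1) * z + of_int (A$1$2)) / (of_int (A$2$1) * z + of_int (A$2$2))))"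

fun cnj_point :: "ext_point \<Rightarrow> ext_point" where
  "cnj_point Infty = Infty"
| "cnj_point (Fin z) = Fin (cnj z)"

text \<open>
  Classes of determinant \<open>-1\<close> act antiholomorphically, by \<open>z \<mapsto> (a cnj(z) + b) / (c cnj(z) + d)\<close>,
  so that all of \<open>PGL(2,\<int>)\<close> preserves the upper half plane. The two matrices \<open>A\<close>, \<open>-A\<close> of a class
  act in the same way, hence the choice below is immaterial.
\<close>

definition pgl_act :: "(int^2^2) set \<Rightarrow> ext_point \<Rightarrow> ext_point" where
  "pgl_act g p = (let A = (SOME A. A \<in> g) in
     if det A = 1 then moebius_point A p else moebius_point A (cnj_point p))"

section \<open>Holomorphic differentials on the compactified modular curve\<close>

text \<open>
  \<open>slash A f\<close> is the coefficient of the pullback of \<open>f(z) dz\<close> along \<open>z \<mapsto> (a z + b) / (c z + d)\<close>.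
\<close>

definition slash :: "int^2^2 \<Rightarrow> (complex \<Rightarrow> complex) \<Rightarrow> complex \<Rightarrow> complex" where
  "slash A f z =
     f ((of_int (A$1$1) * z + of_int (A$1$2)) / (of_int (A$2$1) * z + of_int (A$2$2)))
     * (of_int (det A) / (of_int (A$2$1) * z + of_int (A$2$2))\<^sup>2)"

definition cusp_width :: "(int^2^2) set set \<Rightarrow> int^2^2 \<Rightarrow> nat" where
  "cusp_width G A = (LEAST h. h > 0 \<and>
     pgl A \<otimes>\<^bsub>PGL2Z\<^esub> pgl (mat2 1 (int h) 0 1) \<otimes>\<^bsub>PGL2Z\<^esub> inv\<^bsub>PGL2Z\<^esub> (pgl A) \<in> G)"

text \<open>
  A differential \<open>\<omega>\<close> on the compactification of the quotient \<open>X\<^sub>G\<close> of \<open>\<H>\<close> by \<open>G\<close> is represented by the function \<open>f\<close> with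
  \<open>\<phi>\<^sup>*\<omega> = f(z) dz\<close>, extended by \<open>0\<close> off the upper half plane. At the cusp \<open>A(i\<infinity>)\<close> the local
  coordinate is \<open>q = exp(2 \<pi> i z / h)\<close> with \<open>h\<close> the width, and the last condition says that the
  differential is \<open>F(q) dq\<close> with \<open>F\<close> holomorphic at \<open>q = 0\<close> too.

  If \<open>G\<close> contains elements of determinant \<open>-1\<close>, the quotient is a Klein surface (an orientable
  surface modulo an antiholomorphic involution), whose holomorphic differentials are those that
  antiholomorphic elements send to their complex conjugates. The real forms \<open>Re (f(z) dz)\<close> are then
  precisely the \<open>G\<close>-invariant harmonic ones, for all \<open>G\<close>. For \<open>G\<close> inside \<open>PSL(2,\<int>)\<close> the second
  invariance condition is void and one gets the cusp forms of weight 2.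
\<close>

definition hol_differentials :: "(int^2^2) set set \<Rightarrow> (complex \<Rightarrow> complex) set" where
  "hol_differentials G = {f.
     f holomorphic_on upper_half_plane \<and> (\<forall>z. z \<notin> upper_half_plane \<longrightarrow> f z = 0) \<and>
     (\<forall>A. pgl A \<in> G \<and> det A = 1 \<longrightarrow> (\<forall>z\<in>upper_half_plane. slash A f z = f z)) \<and>
     (\<forall>A. pgl A \<in> G \<and> det A = -1 \<longrightarrow> (\<forall>z\<in>upper_half_plane. slash A f (cnj z) = cnj (f z))) \<and>
     (\<forall>A. det A = 1 \<longrightarrow>
        (\<exists>F. F holomorphic_on ball 0 1 \<and>
           (\<forall>z\<in>upper_half_plane.
              let h = of_nat (cusp_width G A); q = exp (2 * of_real pi * \<i> * z / h)
              in slash A f z = F q * (2 * of_real pi * \<i> / h * q))))}"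

section \<open>Modular symbols\<close>

text \<open>
  The geodesic arc between two points of finite real part, in the upper half plane or on the real
  line: a vertical segment, or an arc of the circle through both points with centre on the real
  line.
\<close>

definition geodesic_arc :: "complex \<Rightarrow> complex \<Rightarrow> real \<Rightarrow> complex" where
  "geodesic_arc a b =
     (if Re a = Re b then linepath a b
      else let c = complex_of_real (((cmod b)\<^sup>2 - (cmod a)\<^sup>2) / (2 * (Re b - Re a)))
           in part_circlepath c (cmod (a - c)) (Arg (a - c)) (Arg (b - c)))"

fun geodesic_integral :: "(complex \<Rightarrow> complex) \<Rightarrow> ext_point \<Rightarrow> ext_point \<Rightarrow> complex" where
  "geodesic_integral f (Fin a) (Fin b) = contour_integral (geodesic_arc a b) f"
| "geodesic_integral f (Fin a) Infty = integral {Im a..} (\<lambda>y. f (Complex (Re a) y) * \<i>)"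
| "geodesic_integral f Infty (Fin b) = - integral {Im b..} (\<lambda>y. f (Complex (Re b) y) * \<i>)"
| "geodesic_integral f Infty Infty = 0"

text \<open>
  A real homology class is determined by its periods, and is represented by the real functional
  \<open>\<omega> \<mapsto> Re \<integral>\<omega>\<close> on the holomorphic differentials (extended by \<open>0\<close>): integration identifies
  \<open>H\<^sub>1\<close> of the compactified curve, with real coefficients, with the real dual of that space. Taking
  real parts makes the pairing \<open>G\<close>-invariant when \<open>G\<close> contains antiholomorphic elements; for \<open>G\<close>
  inside \<open>PSL(2,\<int>)\<close> it amounts to prescribing the complex periods, see the lemma below.
  The space being finite-dimensional, its topology is that of pointwise convergence, i.e. the one
  of the function type.
\<close>

type_synonym homology_class = "(complex \<Rightarrow> complex) \<Rightarrow> real"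

definition modular_symbol ::
    "(int^2^2) set set \<Rightarrow> ext_point \<Rightarrow> ext_point \<Rightarrow> homology_class" where
  "modular_symbol G \<alpha> \<beta> = (\<lambda>\<omega>. if \<omega> \<in> hol_differentials G then Re (geodesic_integral \<omega> \<alpha> \<beta>) else 0)"

lemma geodesic_integral_ii:
  "geodesic_integral (\<lambda>z. \<i> * f z) \<alpha> \<beta> = \<i> * geodesic_integral f \<alpha> \<beta>"
  by (cases \<alpha>; cases \<beta>)
     (simp_all add: contour_integral_integral mult.assoc)

lemma modular_symbol_eq_iff_complex_periods:
  assumes "\<And>A. pgl A \<in> G \<Longrightarrow> det A \<noteq> -1"
  shows "modular_symbol G \<alpha> \<beta> = modular_symbol G \<alpha>' \<beta>' \<longleftrightarrow>
    (\<forall>\<omega>\<in>hol_differentials G. geodesic_integral \<omega> \<alpha> \<beta> = geodesic_integral \<omega> \<alpha>' \<beta>')"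
proof
  assume eq: "modular_symbol G \<alpha> \<beta> = modular_symbol G \<alpha>' \<beta>'"
  have re: "Re (geodesic_integral \<omega> \<alpha> \<beta>) = Re (geodesic_integral \<omega> \<alpha>' \<beta>')"
    if "\<omega> \<in> hol_differentials G" for \<omega>
    using fun_cong[OF eq, of \<omega>] that by (simp add: modular_symbol_def)
  show "\<forall>\<omega>\<in>hol_differentials G. geodesic_integral \<omega> \<alpha> \<beta> = geodesic_integral \<omega> \<alpha>' \<beta>'"
  proof
    fix \<omega> assume \<omega>: "\<omega> \<in> hol_differentials G"
    have slash_ii: "slash A (\<lambda>z. \<i> * \<omega> z) z = \<i> * slash A \<omega> z" for A z
      by (simp add: slash_def)
    have "(\<lambda>z. \<i> * \<omega> z) \<in> hol_differentials G"
      unfolding hol_differentials_def mem_Collect_eq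
    proof (intro conjI allI impI)
      show "(\<lambda>z. \<i> * \<omega> z) holomorphic_on upper_half_plane"
        using \<omega> by (auto simp: hol_differentials_def intro!: holomorphic_intros)
    next
      fix A :: "int^2^2" assume "det A = 1"
      then obtain F where F: "F holomorphic_on ball 0 1"
        "\<forall>z\<in>upper_half_plane.
           let h = of_nat (cusp_width G A); q = exp (2 * of_real pi * \<i> * z / h)
           in slash A \<omega> z = F q * (2 * of_real pi * \<i> / h * q)"
        using \<omega> unfolding hol_differentials_def by blast
      show "\<exists>F. F holomorphic_on ball 0 1 \<and>
        (\<forall>z\<in>upper_half_plane.
           let h = of_nat (cusp_width G A); q = exp (2 * of_real pi * \<i> * z / h)
           in slash A (\<lambda>z. \<i> * \<omega> z) z = F q * (2 * of_real pi * \<i> / h * q))"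
        using F by (intro exI[of _ "\<lambda>q. \<i> * F q"])
          (auto simp: slash_ii Let_def intro!: holomorphic_intros)
    qed (use \<omega> assms in \<open>auto simp: hol_differentials_def slash_ii\<close>)
    from re[OF this] re[OF \<omega>]
    show "geodesic_integral \<omega> \<alpha> \<beta> = geodesic_integral \<omega> \<alpha>' \<beta>'"
      by (simp add: geodesic_integral_ii complex_eq_iff)
  qed
qed (simp add: modular_symbol_def fun_eq_iff)

section \<open>Limiting modular symbols\<close>

definition hyp_dist :: "complex \<Rightarrow> complex \<Rightarrow> real" where
  "hyp_dist z w = arcosh (1 + (cmod (z - w))\<^sup>2 / (2 * Im z * Im w))"

definition vertical_geodesic :: "real \<Rightarrow> complex set" where
  "vertical_geodesic \<beta> = {z. Re z = \<beta> \<and> Im z > 0}"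

definition geodesic_point :: "real \<Rightarrow> complex \<Rightarrow> real \<Rightarrow> complex" where
  "geodesic_point \<beta> x0 \<tau> =
     (THE z. z \<in> vertical_geodesic \<beta> \<and> hyp_dist x0 z = \<tau> \<and> Im z \<le> Im x0)"

definition has_limiting_modular_symbol ::
    "(int^2^2) set set \<Rightarrow> real \<Rightarrow> homology_class \<Rightarrow> bool" where
  "has_limiting_modular_symbol G \<beta> v \<longleftrightarrow>
     (\<forall>x0\<in>vertical_geodesic \<beta>.
        ((\<lambda>\<tau> \<omega>. 1 / \<tau> * modular_symbol G (Fin x0) (Fin (geodesic_point \<beta> x0 \<tau>)) \<omega>)
           \<longlongrightarrow> v) at_top)"

section \<open>The shift, the function \<open>\<phi>\<close> and the Lyapunov exponent\<close>

definition gauss_map :: "real \<Rightarrow> real" where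
  "gauss_map \<beta> = 1 / \<beta> - of_int \<lfloor>1 / \<beta>\<rfloor>"

definition shift :: "real \<times> (int^2^2) set set \<Rightarrow> real \<times> (int^2^2) set set" where
  "shift = (\<lambda>(\<beta>, t). (gauss_map \<beta>, pgl (mat2 (- \<lfloor>1 / \<beta>\<rfloor>) 1 1 0) <#\<^bsub>PGL2Z\<^esub> t))"

definition base_point :: "(int^2^2) set set \<Rightarrow> (int^2^2) set set" where
  "base_point G = \<one>\<^bsub>PGL2Z\<^esub> <#\<^bsub>PGL2Z\<^esub> G"

text \<open>
  When \<open>X\<^sub>G\<close> is identified with the quotient of \<open>\<H> \<times> PGL(2,\<int>)/G\<close> by \<open>PGL(2,\<int>)\<close>,
  the point \<open>(z, gG)\<close> goes to the class of \<open>g\<^sup>-\<^sup>1 z\<close>. The symbol attached to the left coset \<open>gG\<close>,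
  usually written \<open>{g(0), g(i\<infinity>)}\<close>, is therefore formed with \<open>g\<^sup>-\<^sup>1\<close>; with \<open>g\<close> itself it would depend
  on the representative. The orientation, from \<open>i\<infinity>\<close> to \<open>0\<close>, is the one for which the
  symbol at the coset \<open>shift\<^sup>k\<close> of the base point is \<open>{p\<^sub>k\<^sub>-\<^sub>1/q\<^sub>k\<^sub>-\<^sub>1, p\<^sub>k/q\<^sub>k}\<close>, in the direction of \<open>\<beta>\<close>:
  the coset is \<open>g\<^sub>k\<^sup>-\<^sup>1 G\<close> with \<open>g\<^sub>k = (p\<^sub>k\<^sub>-\<^sub>1, p\<^sub>k; q\<^sub>k\<^sub>-\<^sub>1, q\<^sub>k)\<close>, and \<open>g\<^sub>k(i\<infinity>) = p\<^sub>k\<^sub>-\<^sub>1/q\<^sub>k\<^sub>-\<^sub>1\<close>,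
  \<open>g\<^sub>k(0) = p\<^sub>k/q\<^sub>k\<close>.
\<close>

definition coset_symbol :: "(int^2^2) set set \<Rightarrow> (int^2^2) set set \<Rightarrow> homology_class" where
  "coset_symbol G s = (let g = inv\<^bsub>PGL2Z\<^esub> (SOME g. g \<in> s)
     in modular_symbol G (pgl_act g Infty) (pgl_act g (Fin 0)))"

text \<open>
  The exponent is considered at irrational points only: at a rational one some iterate of the Gauss
  map is \<open>0\<close>, where that map is not defined.
\<close>

definition has_lyapunov_exponent :: "real \<Rightarrow> real \<Rightarrow> bool" where
  "has_lyapunov_exponent \<beta> c \<longleftrightarrow> \<beta> \<notin> \<rat> \<and>
     (\<lambda>n. 1 / real n * ln \<bar>deriv (gauss_map ^^ n) \<beta>\<bar>) \<longlonglongrightarrow> c"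

definition lyapunov_level :: "real \<Rightarrow> real set" where
  "lyapunov_level c = {\<beta>\<in>{0..1}. has_lyapunov_exponent \<beta> c}"

end

theory Submission
  imports Defs "HOL-Real_Asymp.Real_Asymp"
begin

text \<open>
  Let \<open>f(z) dz\<close> be a holomorphic differential on the compactified curve and \<open>\<Phi>\<close> a primitive of \<open>f\<close>
  on the upper half plane. In the local coordinate of a cusp \<open>\<Phi>\<close> is a holomorphic function on the
  whole unit disc, so it has a limit at every cusp, and on the horoballs of height at least \<open>1/2\<close> it
  differs from that limit by a bounded amount; as \<open>G\<close> has finite index, one bound serves all cusps.
  The symbol of the \<open>k\<close>-th coset is the difference of the values of \<open>\<Phi>\<close> at two consecutive
  convergents of \<open>\<beta>\<close>, hence the sum telescopes. Writing \<open>\<delta>\<^sub>n\<close> for the product of the first \<open>n\<close>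
  iterates of \<open>\<beta>\<close> under the Gauss map, the points \<open>\<beta> + i y\<close> with
  \<open>\<delta>\<^sub>n\<^sub>+\<^sub>1\<^sup>2 \<le> y \<le> \<delta>\<^sub>n\<^sup>2\<close> lie in the horoball of height \<open>1/2\<close> at the convergent \<open>p\<^sub>n/q\<^sub>n\<close>. So
  the sum up to \<open>n\<close> and the integral down to height \<open>y\<close> differ by \<open>O(1)\<close>, while the hyperbolic
  length is \<open>- 2 ln \<delta>\<^sub>n + O(1)\<close> at the start of that interval. Finally \<open>- 2 ln \<delta>\<^sub>n\<close> is the logarithm
  of the derivative of the \<open>n\<close>-th iterate of the Gauss map, which is asymptotic to \<open>c n\<close>.
\<close>

no_notation fps_nth (infixl \<open>$\<close> 75)

section \<open>The group \<open>PGL(2,\<int>)\<close>\<close>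

lemma mat2_nth [simp]:
  "mat2 a b c d $ 1 $ 1 = a" "mat2 a b c d $ 1 $ 2 = b"
  "mat2 a b c d $ 2 $ 1 = c" "mat2 a b c d $ 2 $ 2 = d"
  by (simp_all add: mat2_def)

lemma mat2_mult:
  "mat2 a b c d ** mat2 a' b' c' d' = mat2 (a*a'+b*c') (a*b'+b*d') (c*a'+d*c') (c*b'+d*d')"
  by (simp add: vec_eq_iff forall_2 matrix_matrix_mult_def sum_2)

lemma det_mat2 [simp]: "det (mat2 a b c d) = a * d - b * c"
  by (simp add: det_2)

lemma mat_1_eq_mat2: "(mat 1 :: int^2^2) = mat2 1 0 0 1"
  by (simp add: vec_eq_iff forall_2 mat_def)

lemma det_uminus_2: "det (- A) = det (A :: int^2^2)"
  by (simp add: det_2)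

lemma GL2Z_carrier [simp]: "A \<in> carrier GL2Z \<longleftrightarrow> det A = 1 \<or> det A = - 1"
  by (simp add: GL2Z_def)

lemma GL2Z_mult [simp]: "A \<otimes>\<^bsub>GL2Z\<^esub> B = A ** B"
  by (simp add: GL2Z_def)

lemma GL2Z_one [simp]: "\<one>\<^bsub>GL2Z\<^esub> = mat 1"
  by (simp add: GL2Z_def)

text \<open>The adjugate times \<open>det A\<close>: for determinant \<plusminus>1 that factor is
  its own inverse, so both signs are covered without division.\<close>

definition GL2Z_inverse :: "int^2^2 \<Rightarrow> int^2^2" where
  "GL2Z_inverse A = mat2 (det A * A$2$2) (- det A * A$1$2) (- det A * A$2$1) (det A * A$1$1)"

lemma
  assumes "det A = 1 \<or> det A = - 1"
  shows GL2Z_inverse_left: "GL2Z_inverse A ** A = mat 1"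
    and GL2Z_inverse_right: "A ** GL2Z_inverse A = mat 1"
    and det_GL2Z_inverse: "det (GL2Z_inverse A) = det A"
proof -
  have D: "det A * det A = 1" using assms by auto
  have "GL2Z_inverse A ** A = mat2 (det A * det A) 0 0 (det A * det A)"
    "A ** GL2Z_inverse A = mat2 (det A * det A) 0 0 (det A * det A)"
    by (simp_all add: GL2Z_inverse_def vec_eq_iff forall_2 matrix_matrix_mult_def sum_2 det_2
        algebra_simps)
  then show "GL2Z_inverse A ** A = mat 1" "A ** GL2Z_inverse A = mat 1"
    by (simp_all add: D mat_1_eq_mat2)
  have "det (GL2Z_inverse A) = det A * det A * det A"
    by (simp add: GL2Z_inverse_def det_2 algebra_simps)
  then show "det (GL2Z_inverse A) = det A"
    by (simp add: D)
qed

lemma group_GL2Z: "group GL2Z"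
proof (rule groupI)
  fix A assume "A \<in> carrier GL2Z"
  then show "\<exists>B\<in>carrier GL2Z. B \<otimes>\<^bsub>GL2Z\<^esub> A = \<one>\<^bsub>GL2Z\<^esub>"
    by (intro bexI[of _ "GL2Z_inverse A"]) (auto simp: GL2Z_inverse_left det_GL2Z_inverse)
qed (auto simp: det_mul matrix_mul_assoc)

lemma uminus_one_mult: "- mat 1 ** A = - A" "A ** - mat 1 = - (A :: int^2^2)"
  by (simp_all add: vec_eq_iff forall_2 matrix_matrix_mult_def sum_2 mat_def)

lemma inv_uminus_one: "inv\<^bsub>GL2Z\<^esub> (- mat 1) = - mat 1"
  by (rule group.inv_equality[OF group_GL2Z]) (auto simp: uminus_one_mult det_uminus_2)

lemma inv_one_GL2Z: "inv\<^bsub>GL2Z\<^esub> (mat 1) = mat 1"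
  by (rule group.inv_equality[OF group_GL2Z]) auto

lemma pgl_eq: "pgl A = {A, - A}"
  by (auto simp: pgl_def r_coset_def uminus_one_mult)

lemma normal_center_GL2Z: "{mat 1, - mat 1} \<lhd> GL2Z"
proof (rule group.normalI[OF group_GL2Z])
  show "subgroup {mat 1, - mat 1} GL2Z"
    by (rule group.subgroupI[OF group_GL2Z])
      (auto simp: det_uminus_2 uminus_one_mult inv_uminus_one inv_one_GL2Z)
  show "\<forall>A\<in>carrier GL2Z. {mat 1, - mat 1} #>\<^bsub>GL2Z\<^esub> A = A <#\<^bsub>GL2Z\<^esub> {mat 1, - mat 1}"
    by (auto simp: r_coset_def l_coset_def uminus_one_mult)
qed

lemma group_PGL2Z: "group PGL2Z"
  unfolding PGL2Z_def by (rule normal.factorgroup_is_group[OF normal_center_GL2Z])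

lemma PGL2Z_carrier: "carrier PGL2Z = pgl ` {A. det A = 1 \<or> det A = - 1}"
  by (auto simp: PGL2Z_def FactGroup_def RCOSETS_def pgl_def GL2Z_def)

lemma pgl_in_carrier: "det A = 1 \<or> det A = - 1 \<Longrightarrow> pgl A \<in> carrier PGL2Z"
  by (auto simp: PGL2Z_carrier)

lemma pgl_mult:
  assumes "det A = 1 \<or> det A = - 1" "det B = 1 \<or> det B = - 1"
  shows "pgl A \<otimes>\<^bsub>PGL2Z\<^esub> pgl B = pgl (A ** B)"
  using normal.rcos_sum[OF normal_center_GL2Z, of A B] assms
  by (simp add: PGL2Z_def FactGroup_def pgl_def)

lemma pgl_one: "\<one>\<^bsub>PGL2Z\<^esub> = pgl (mat 1)"
  by (simp add: PGL2Z_def FactGroup_def pgl_eq)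

lemma inv_pgl:
  assumes "det A = 1 \<or> det A = - 1"
  shows "inv\<^bsub>PGL2Z\<^esub> (pgl A) = pgl (GL2Z_inverse A)"
  using assms
  by (intro group.inv_equality[OF group_PGL2Z])
    (auto simp: pgl_mult det_GL2Z_inverse GL2Z_inverse_left pgl_one pgl_in_carrier)

lemma base_point_eq: "subgroup G PGL2Z \<Longrightarrow> base_point G = G"
  unfolding base_point_def
  by (rule group.lcos_mult_one[OF group_PGL2Z]) (rule subgroup.subset)

section \<open>Cusps as columns of matrices, and the symbols of cosets\<close>

definition cusp_point :: "int \<Rightarrow> int \<Rightarrow> ext_point" where
  "cusp_point p q = (if q = 0 then Infty else Fin (of_int p / of_int q))"

text \<open>The representative chosen in \<open>pgl_act\<close> is \<open>B\<close> or
  \<open>- B\<close>, whose columns have the same ratios. Conjugation fixes both points, so the sign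
  of the determinant has no effect either.\<close>

lemma pgl_act_cusps:
  assumes "det B = 1 \<or> det B = - 1"
  shows "pgl_act (pgl B) Infty = cusp_point (B$1$1) (B$2$1)"
    and "pgl_act (pgl B) (Fin 0) = cusp_point (B$1$2) (B$2$2)"
proof -
  define A where "A = (SOME A. A \<in> pgl B)"
  have "A \<in> pgl B" unfolding A_def by (rule someI[of _ B]) (simp add: pgl_eq)
  then have "A = B \<or> A = - B" by (simp add: pgl_eq)
  then show "pgl_act (pgl B) Infty = cusp_point (B$1$1) (B$2$1)"
    and "pgl_act (pgl B) (Fin 0) = cusp_point (B$1$2) (B$2$2)"
    unfolding pgl_act_def A_def[symmetric] Let_def cusp_point_def by auto
qed

text \<open>The element picked by \<open>SOME\<close> is \<open>pgl (GL2Z_inverse B)\<close> times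
  an unknown \<open>\<gamma>\<close> in \<open>G\<close>, so its inverse is the class of
  \<open>C ** B\<close> with \<open>C\<close> representing the inverse of \<open>\<gamma>\<close>.
  The factor \<open>C\<close> disappears later through invariance under \<open>G\<close>.\<close>

lemma coset_symbol_coset:
  assumes G: "subgroup G PGL2Z" and B: "det B = 1 \<or> det B = - 1"
  obtains C where "det C = 1 \<or> det C = - 1" "pgl C \<in> G"
    "coset_symbol G (pgl (GL2Z_inverse B) <#\<^bsub>PGL2Z\<^esub> G) =
      modular_symbol G (cusp_point ((C ** B)$1$1) ((C ** B)$2$1))
        (cusp_point ((C ** B)$1$2) ((C ** B)$2$2))"
proof -
  interpret group PGL2Z by (rule group_PGL2Z)
  interpret subgroup G PGL2Z by (rule G)
  define g where "g = (SOME g. g \<in> pgl (GL2Z_inverse B) <#\<^bsub>PGL2Z\<^esub> G)"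
  have carB: "pgl B \<in> carrier PGL2Z" "pgl (GL2Z_inverse B) \<in> carrier PGL2Z"
    using B by (auto intro: pgl_in_carrier simp: det_GL2Z_inverse)
  have "g \<in> pgl (GL2Z_inverse B) <#\<^bsub>PGL2Z\<^esub> G"
    unfolding g_def by (rule someI) (rule lcos_self[OF carB(2) G])
  then obtain \<gamma> where \<gamma>: "\<gamma> \<in> G" "g = pgl (GL2Z_inverse B) \<otimes>\<^bsub>PGL2Z\<^esub> \<gamma>"
    by (auto simp: l_coset_def)
  have "inv\<^bsub>PGL2Z\<^esub> \<gamma> \<in> carrier PGL2Z" using \<gamma> by auto
  then obtain C where C: "det C = 1 \<or> det C = - 1" "inv\<^bsub>PGL2Z\<^esub> \<gamma> = pgl C"
    by (auto simp: PGL2Z_carrier)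
  have "inv\<^bsub>PGL2Z\<^esub> g = inv\<^bsub>PGL2Z\<^esub> \<gamma> \<otimes>\<^bsub>PGL2Z\<^esub> pgl B"
    using \<gamma> carB B by (simp add: inv_mult_group inv_pgl[symmetric])
  then have g: "inv\<^bsub>PGL2Z\<^esub> g = pgl (C ** B)"
    using C B by (simp add: pgl_mult)
  have "det (C ** B) = 1 \<or> det (C ** B) = - 1"
    using C B by (auto simp: det_mul)
  moreover have "pgl C \<in> G" using C \<gamma> m_inv_closed by metis
  ultimately show ?thesis
    using that[OF C(1)] g unfolding coset_symbol_def g_def[symmetric] Let_def
    by (simp add: pgl_act_cusps)
qed

section \<open>The Gauss map and continued fractions\<close>

lemma gauss_map_unit:
  assumes "0 < x" "x < 1" "x \<notin> \<rat>"
  shows "0 < gauss_map x" "gauss_map x < 1" "gauss_map x \<notin> \<rat>" "1 \<le> \<lfloor>1 / x\<rfloor>"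
proof -
  have "1 / x \<notin> \<rat>"
    using Rats_inverse[of "1 / x"] assms by (auto simp: inverse_eq_divide)
  then show irr: "gauss_map x \<notin> \<rat>"
    using Rats_add[of "gauss_map x" "of_int \<lfloor>1 / x\<rfloor>"] by (auto simp: gauss_map_def)
  then have "gauss_map x \<noteq> 0" by auto
  then show "0 < gauss_map x" "gauss_map x < 1"
    unfolding gauss_map_def by linarith+
  show "1 \<le> \<lfloor>1 / x\<rfloor>" using assms by (simp add: le_floor_iff)
qed

lemma gauss_map_iterate_unit:
  assumes "0 < x" "x < 1" "x \<notin> \<rat>"
  shows "0 < (gauss_map ^^ k) x \<and> (gauss_map ^^ k) x < 1 \<and> (gauss_map ^^ k) x \<notin> \<rat>"
  by (induction k) (use assms gauss_map_unit in auto)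

text \<open>An irrational \<open>x\<close> has \<open>1 / x\<close> strictly between two integers,
  so the floor is constant near \<open>x\<close>.\<close>

lemma gauss_map_has_derivative:
  assumes "0 < x" "x < 1" "x \<notin> \<rat>"
  shows "(gauss_map has_field_derivative - 1 / x\<^sup>2) (at x)"
proof -
  define a where "a = \<lfloor>1 / x\<rfloor>"
  have ia: "of_int a < 1 / x" "1 / x < of_int a + 1"
    using gauss_map_unit[OF assms] by (auto simp: gauss_map_def a_def)
  have cont: "((\<lambda>y. 1 / y) \<longlongrightarrow> 1 / x) (nhds x)"
    using assms by (intro tendsto_intros) (auto simp: filterlim_ident)
  have "eventually (\<lambda>y. gauss_map y = 1 / y - of_int a) (nhds x)"
    using order_tendstoD(1)[OF cont ia(1)] order_tendstoD(2)[OF cont ia(2)]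
  proof eventually_elim
    case (elim y)
    then have "\<lfloor>1 / y\<rfloor> = a" by (simp add: floor_eq_iff)
    then show ?case by (simp add: gauss_map_def)
  qed
  moreover have "((\<lambda>y. 1 / y - of_int a) has_field_derivative - 1 / x\<^sup>2) (at x)"
    using assms by (auto intro!: derivative_eq_intros simp: power2_eq_square)
  ultimately show ?thesis by (subst DERIV_cong_ev[OF refl _ refl])
qed

text \<open>This is \<open>\<delta>\<^sub>k\<close>. It measures both the derivative of the iterates
  (\<open>abs_deriv_gauss_map_iterate\<close>) and the quality of the convergents
  (\<open>conv_error\<close>).\<close>

definition gauss_product :: "real \<Rightarrow> nat \<Rightarrow> real" where
  "gauss_product x k = (\<Prod>j<k. (gauss_map ^^ j) x)"

lemma gauss_product_0 [simp]: "gauss_product x 0 = 1"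
  and gauss_product_Suc: "gauss_product x (Suc k) = gauss_product x k * (gauss_map ^^ k) x"
  by (simp_all add: gauss_product_def)

text \<open>Chain rule along the orbit. It turns the Lyapunov exponent into the growth rate of
  \<open>- 2 * ln (gauss_product x n)\<close>.\<close>

lemma abs_deriv_gauss_map_iterate:
  assumes "0 < x" "x < 1" "x \<notin> \<rat>"
  shows "\<bar>deriv (gauss_map ^^ n) x\<bar> = 1 / (gauss_product x n)\<^sup>2"
proof -
  have "((gauss_map ^^ n) has_field_derivative (\<Prod>j<n. - 1 / ((gauss_map ^^ j) x)\<^sup>2)) (at x)"
  proof (induction n)
    case 0
    then show ?case by (simp add: id_def)
  next
    case (Suc n)
    have "(gauss_map has_field_derivative - 1 / ((gauss_map ^^ n) x)\<^sup>2) (at ((gauss_map ^^ n) x))"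
      using gauss_map_iterate_unit[OF assms] by (intro gauss_map_has_derivative) auto
    from DERIV_chain[OF this Suc] show ?case by (simp add: mult.commute o_def)
  qed
  then have "deriv (gauss_map ^^ n) x = (\<Prod>j<n. - 1 / ((gauss_map ^^ j) x)\<^sup>2)"
    by (rule DERIV_imp_deriv)
  then show ?thesis
    by (simp add: abs_prod gauss_product_def prod_dividef prod_power_distrib)
qed

lemma gauss_product_pos:
  assumes "0 < x" "x < 1" "x \<notin> \<rat>"
  shows "0 < gauss_product x n"
  unfolding gauss_product_def using gauss_map_iterate_unit[OF assms] by (simp add: prod_pos)

lemma gauss_product_Suc_le:
  assumes "0 < x" "x < 1" "x \<notin> \<rat>"
  shows "gauss_product x (Suc n) \<le> gauss_product x n"
  using gauss_product_pos[OF assms, of n] gauss_map_iterate_unit[OF assms, of n]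
  by (simp add: gauss_product_Suc mult_left_le)

lemma gauss_map_mult:
  assumes "0 < x" "x < 1" "x \<notin> \<rat>"
  shows "x * gauss_map x = 1 - of_int \<lfloor>1 / x\<rfloor> * x"
  using assms by (simp add: gauss_map_def field_simps)

text \<open>Two consecutive iterates \<open>y\<close> and \<open>gauss_map y\<close> have a product
  bounded by \<open>y\<close> and, as the partial quotient is at least 1, by \<open>1 - y\<close>;
  so each pair contributes at most 1/2.\<close>

lemma gauss_product_even_le:
  assumes "0 < x" "x < 1" "x \<notin> \<rat>"
  shows "gauss_product x (2 * k) \<le> (1/2) ^ k"
proof (induction k)
  case 0
  then show ?case by simp
next
  case (Suc k)
  define y where "y = (gauss_map ^^ (2 * k)) x"
  have y: "0 < y" "y < 1" "y \<notin> \<rat>"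
    using gauss_map_iterate_unit[OF assms] by (auto simp: y_def)
  have "y * gauss_map y \<le> 1 - y"
    using gauss_map_mult[OF y] gauss_map_unit(4)[OF y] y
    by (metis diff_left_mono mult_right_mono of_int_1_le_iff less_imp_le mult_1)
  moreover have "y * gauss_map y \<le> y"
    using y gauss_map_unit[OF y] by (simp add: mult_left_le)
  ultimately have "y * gauss_map y \<le> 1/2" by linarith
  then have "gauss_product x (2 * k) * (y * gauss_map y) \<le> (1/2)^k * (1/2)"
    using Suc gauss_product_pos[OF assms, of "2*k"] y gauss_map_unit[OF y]
    by (intro mult_mono) auto
  then show ?case by (simp add: gauss_product_Suc y_def mult.assoc)
qed

section \<open>Convergents and the orbit of the base point under the shift\<close>

text \<open>The index is shifted by one: \<open>conv_num a n / conv_den a n\<close> is the convergent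
  \<open>p\<^sub>n\<^sub>-\<^sub>1/q\<^sub>n\<^sub>-\<^sub>1\<close> of the continued fraction with partial quotients \<open>a 0, a 1, \<dots>\<close>
  and integral part \<open>0\<close>.\<close>

fun conv_num :: "(nat \<Rightarrow> int) \<Rightarrow> nat \<Rightarrow> int" where
  "conv_num a 0 = 1"
| "conv_num a (Suc 0) = 0"
| "conv_num a (Suc (Suc n)) = a n * conv_num a (Suc n) + conv_num a n"

fun conv_den :: "(nat \<Rightarrow> int) \<Rightarrow> nat \<Rightarrow> int" where
  "conv_den a 0 = 0"
| "conv_den a (Suc 0) = 1"
| "conv_den a (Suc (Suc n)) = a n * conv_den a (Suc n) + conv_den a n"

text \<open>With the shifted index this is the matrix \<open>g\<^sub>k\<close> whose columns are the
  convergents \<open>p\<^sub>k\<^sub>-\<^sub>1/q\<^sub>k\<^sub>-\<^sub>1\<close> and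
  \<open>p\<^sub>k/q\<^sub>k\<close>, the images of \<open>i\<infinity>\<close> and 0.\<close>

definition conv_mat :: "(nat \<Rightarrow> int) \<Rightarrow> nat \<Rightarrow> int^2^2" where
  "conv_mat a k = mat2 (conv_num a k) (conv_num a (Suc k)) (conv_den a k) (conv_den a (Suc k))"

definition partial_quotient :: "real \<Rightarrow> nat \<Rightarrow> int" where
  "partial_quotient x k = \<lfloor>1 / (gauss_map ^^ k) x\<rfloor>"

lemma conv_mat_0: "conv_mat a 0 = mat 1"
  by (simp add: conv_mat_def mat_1_eq_mat2)

lemma conv_mat_Suc: "conv_mat a (Suc k) = conv_mat a k ** mat2 0 1 1 (a k)"
  by (simp add: conv_mat_def mat2_mult mult.commute add.commute)

lemma det_conv_mat: "det (conv_mat a k) = 1 \<or> det (conv_mat a k) = - 1"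
  by (induction k) (auto simp: conv_mat_0 conv_mat_Suc det_mul)

lemma coprime_conv: "coprime (conv_num a k) (conv_den a k)"
proof (rule coprimeI)
  fix d assume "d dvd conv_num a k" "d dvd conv_den a k"
  then have "d dvd det (conv_mat a k)"
    unfolding conv_mat_def det_mat2 by (intro dvd_diff dvd_mult dvd_mult2) auto
  then show "is_unit d" using det_conv_mat[of a k] by auto
qed

text \<open>The matrix of the shift is the inverse of the factor \<open>mat2 0 1 1 a\<close> in
  \<open>conv_mat_Suc\<close>. Appending that factor on the right of \<open>g\<^sub>k\<close>
  therefore multiplies the inverse of \<open>g\<^sub>k\<close> on the left by the shift
  matrix.\<close>

lemma shift_iterate:
  assumes G: "subgroup G PGL2Z"
  shows "(shift ^^ k) (x, G) =
    ((gauss_map ^^ k) x, pgl (GL2Z_inverse (conv_mat (partial_quotient x) k)) <#\<^bsub>PGL2Z\<^esub> G)"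
proof (induction k)
  case 0
  have "pgl (GL2Z_inverse (mat 1)) = \<one>\<^bsub>PGL2Z\<^esub>"
    using pgl_one GL2Z_inverse_left[of "mat 1"] by simp
  then show ?case
    using base_point_eq[OF G] by (simp add: conv_mat_0 base_point_def)
next
  case (Suc k)
  let ?B = "conv_mat (partial_quotient x) k"
  let ?a = "partial_quotient x k"
  have inv: "GL2Z_inverse (?B ** mat2 0 1 1 ?a) = mat2 (- ?a) 1 1 0 ** GL2Z_inverse ?B"
    by (simp add: GL2Z_inverse_def vec_eq_iff forall_2 matrix_matrix_mult_def sum_2 det_2
        algebra_simps)
  have 1: "pgl (mat2 (- ?a) 1 1 0) \<otimes>\<^bsub>PGL2Z\<^esub> pgl (GL2Z_inverse ?B) =
      pgl (GL2Z_inverse (conv_mat (partial_quotient x) (Suc k)))"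
    using det_conv_mat[of "partial_quotient x" k]
    by (simp add: pgl_mult det_GL2Z_inverse conv_mat_Suc inv)
  have "pgl (mat2 (- ?a) 1 1 0) <#\<^bsub>PGL2Z\<^esub> (pgl (GL2Z_inverse ?B) <#\<^bsub>PGL2Z\<^esub> G) =
      pgl (GL2Z_inverse (conv_mat (partial_quotient x) (Suc k))) <#\<^bsub>PGL2Z\<^esub> G"
    unfolding 1[symmetric] using det_conv_mat[of "partial_quotient x" k]
    by (intro group.lcos_m_assoc[OF group_PGL2Z] subgroup.subset[OF G] pgl_in_carrier)
      (auto simp: det_GL2Z_inverse)
  then have "shift ((gauss_map ^^ k) x, pgl (GL2Z_inverse ?B) <#\<^bsub>PGL2Z\<^esub> G) =
      ((gauss_map ^^ Suc k) x,
       pgl (GL2Z_inverse (conv_mat (partial_quotient x) (Suc k))) <#\<^bsub>PGL2Z\<^esub> G)"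
    by (simp add: shift_def partial_quotient_def[of x k])
  then show ?case using Suc by simp
qed

context
  fixes x :: real
  assumes x: "0 < x" "x < 1" "x \<notin> \<rat>"
begin

private abbreviation "P k \<equiv> real_of_int (conv_num (partial_quotient x) k)"
private abbreviation "Q k \<equiv> real_of_int (conv_den (partial_quotient x) k)"

lemma partial_quotient_mult:
  "of_int (partial_quotient x k) * (gauss_map ^^ k) x =
    1 - (gauss_map ^^ k) x * (gauss_map ^^ Suc k) x"
  using gauss_map_mult[of "(gauss_map ^^ k) x"] gauss_map_iterate_unit[OF x, of k]
  by (simp add: partial_quotient_def)

text \<open>By \<open>partial_quotient_mult\<close>, \<open>\<delta>\<^sub>k = a\<^sub>k
  \<delta>\<^sub>k\<^sub>+\<^sub>1 + \<delta>\<^sub>k\<^sub>+\<^sub>2\<close>. With alternating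
  signs this is the recursion of the convergents.\<close>

lemma conv_error: "Q k * x - P k = (- 1) ^ Suc k * gauss_product x k"
proof (induction k rule: induct_nat_012)
  case 0
  then show ?case by simp
next
  case 1
  then show ?case by (simp add: gauss_product_Suc)
next
  case (ge2 k)
  let ?a = "real_of_int (partial_quotient x k)"
  have "Q (Suc (Suc k)) * x - P (Suc (Suc k)) =
      ?a * (Q (Suc k) * x - P (Suc k)) + (Q k * x - P k)"
    by (simp add: algebra_simps)
  also have "\<dots> = (- 1) ^ k * gauss_product x k * (?a * (gauss_map ^^ k) x - 1)"
    unfolding ge2 by (simp add: gauss_product_Suc algebra_simps)
  also have "\<dots> = (- 1) ^ Suc (Suc (Suc k)) * gauss_product x (Suc (Suc k))"
    unfolding partial_quotient_mult by (simp add: gauss_product_Suc)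
  finally show ?case .
qed

text \<open>The left side does not change from \<open>k\<close> to \<open>k + 1\<close>: the
  recursion of the denominators and that of \<open>\<delta>\<^sub>k\<close> compensate each other.
  The identity serves to bound the denominator of a convergent by the inverse of
  \<open>\<delta>\<^sub>k\<close>.\<close>

lemma gauss_product_conv_den:
  "gauss_product x k * Q (Suc k) + gauss_product x (Suc k) * Q k = 1"
proof (induction k)
  case 0
  then show ?case by simp
next
  case (Suc k)
  let ?a = "real_of_int (partial_quotient x k)"
  have "gauss_product x (Suc k) * Q (Suc (Suc k)) + gauss_product x (Suc (Suc k)) * Q (Suc k) =
      gauss_product x k * Q (Suc k) *
        (?a * (gauss_map ^^ k) x + (gauss_map ^^ k) x * (gauss_map ^^ Suc k) x)
      + gauss_product x (Suc k) * Q k"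
    by (simp add: gauss_product_Suc algebra_simps)
  also have "\<dots> = 1" using Suc unfolding partial_quotient_mult by simp
  finally show ?case .
qed

lemma conv_den_nonneg: "0 \<le> conv_den (partial_quotient x) k"
proof (induction k rule: induct_nat_012)
  case (ge2 k)
  have "0 \<le> partial_quotient x k"
    using gauss_map_unit(4) gauss_map_iterate_unit[OF x, of k] by (force simp: partial_quotient_def)
  then show ?case using ge2 by simp
qed auto

lemma gauss_product_mult_conv_den_le: "gauss_product x k * Q (Suc k) \<le> 1"
proof -
  have "0 \<le> gauss_product x (Suc k) * Q k"
    using gauss_product_pos[OF x, of "Suc k"] conv_den_nonneg by simp
  then show ?thesis using gauss_product_conv_den[of k] by linarith
qed

end

lemma lyapunov_level_conv:
  assumes "x \<in> lyapunov_level c"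
  shows "0 < x" "x < 1" "x \<notin> \<rat>"
    and "(\<lambda>n. - 2 * ln (gauss_product x n) / real n) \<longlonglongrightarrow> c" "0 < c"
proof -
  have "x \<in> {0..1}" and irr: "x \<notin> \<rat>"
    and lim: "(\<lambda>n. 1 / real n * ln \<bar>deriv (gauss_map ^^ n) x\<bar>) \<longlonglongrightarrow> c"
    using assms by (auto simp: lyapunov_level_def has_lyapunov_exponent_def)
  moreover have "x \<noteq> 0" "x \<noteq> 1" using irr by auto
  ultimately show x: "0 < x" "x < 1" "x \<notin> \<rat>" by auto
  show lim': "(\<lambda>n. - 2 * ln (gauss_product x n) / real n) \<longlonglongrightarrow> c"
  proof -
    have "1 / real n * ln \<bar>deriv (gauss_map ^^ n) x\<bar> = - 2 * ln (gauss_product x n) / real n" for n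
      using gauss_product_pos[OF x, of n]
      by (simp add: abs_deriv_gauss_map_iterate[OF x] ln_div ln_realpow)
    then show ?thesis using lim by simp
  qed
  \<comment> \<open>Positivity of \<open>c\<close> comes from the even indices, where
    \<open>\<delta>\<^sub>n\<close> decays at least geometrically. Using \<open>Suc k\<close> keeps
    the index away from 0.\<close>
  have "strict_mono (\<lambda>k. 2 * Suc k)" by (auto simp: strict_mono_def)
  from LIMSEQ_subseq_LIMSEQ[OF lim' this]
  have "(\<lambda>k. - 2 * ln (gauss_product x (2 * Suc k)) / real (2 * Suc k)) \<longlonglongrightarrow> c"
    by (simp add: o_def)
  moreover have "ln 2 \<le> - 2 * ln (gauss_product x (2 * Suc k)) / real (2 * Suc k)" for k
  proof -
    have "ln (gauss_product x (2 * Suc k)) \<le> ln ((1/2) ^ Suc k)"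
      using gauss_product_even_le[OF x, of "Suc k"] gauss_product_pos[OF x, of "2 * Suc k"]
      by (subst ln_le_cancel_iff) auto
    also have "\<dots> = - real (Suc k) * ln 2"
      by (subst ln_realpow) (auto simp: ln_div algebra_simps)
    finally show ?thesis by (simp add: field_simps)
  qed
  ultimately have "ln 2 \<le> c" by (intro LIMSEQ_le_const) auto
  then show "0 < c" using ln_gt_zero[of 2] by linarith
qed

section \<open>Comparison of averages in continuous and in discrete time\<close>

text \<open>Below, \<open>\<kappa> + l n\<close> is the time at which the geodesic enters the horoball of the convergent
  \<open>p\<^sub>n/q\<^sub>n\<close>.\<close>

lemma renewal_limit_iff:
  fixes l S :: "nat \<Rightarrow> real" and W :: "real \<Rightarrow> real"
  assumes l: "l 0 = 0" "\<And>n. l n \<le> l (Suc n)" "(\<lambda>n. l n / real n) \<longlonglongrightarrow> c" "0 < c"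
    and close: "\<And>n \<tau>. 0 \<le> \<tau> \<Longrightarrow> l n \<le> \<tau> - \<kappa> \<Longrightarrow> \<tau> - \<kappa> \<le> l (Suc n) \<Longrightarrow> \<bar>W \<tau> - S n\<bar> \<le> M"
  shows "((\<lambda>\<tau>. W \<tau> / \<tau>) \<longlongrightarrow> v) at_top \<longleftrightarrow> (\<lambda>n. S n / (c * real n)) \<longlonglongrightarrow> v"
proof -
  have "filterlim (\<lambda>n. l n / real n * real n) at_top sequentially"
    using l by (intro filterlim_tendsto_pos_mult_at_top[OF l(3,4)] filterlim_real_sequentially)
  \<comment> \<open>At \<open>n = 0\<close> the left side is 0 by the convention on division, which
    agrees with \<open>l 0 = 0\<close>.\<close>
  moreover have "l n / real n * real n = l n" for n using l(1) by (cases n) auto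
  ultimately have l_top: "filterlim l at_top sequentially" by simp
  have mono: "l m \<le> l n" if "m \<le> n" for m n
    using that l(2) lift_Suc_mono_le by blast
  have n_inv: "(\<lambda>n. K / real n) \<longlonglongrightarrow> 0" for K
    by (rule real_tendsto_divide_at_top[OF tendsto_const filterlim_real_sequentially])
  show ?thesis
  proof
    assume W: "((\<lambda>\<tau>. W \<tau> / \<tau>) \<longlongrightarrow> v) at_top"
    \<comment> \<open>Sampling at the entry times suffices: they tend to infinity and are asymptotic
      to \<open>c * real n\<close>, so the two normalisations agree in the limit.\<close>
    define \<tau> where "\<tau> n = \<kappa> + l n" for n
    have \<tau>_top: "filterlim \<tau> at_top sequentially"
      unfolding \<tau>_def by (rule filterlim_tendsto_add_at_top[OF tendsto_const l_top])
    have 1: "(\<lambda>n. W (\<tau> n) / \<tau> n) \<longlonglongrightarrow> v"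
      using filterlim_compose[OF W \<tau>_top] .
    have "(\<lambda>n. l n / real n + \<kappa> / real n) \<longlonglongrightarrow> c + 0"
      by (intro tendsto_add l n_inv)
    then have "(\<lambda>n. (l n / real n + \<kappa> / real n) / c) \<longlonglongrightarrow> (c + 0) / c"
      using l by (intro tendsto_divide tendsto_const) auto
    then have 2: "(\<lambda>n. \<tau> n / (c * real n)) \<longlonglongrightarrow> 1"
      using l by (simp add: \<tau>_def add_divide_distrib mult.commute add.commute)
    have 3: "(\<lambda>n. (S n - W (\<tau> n)) / (c * real n)) \<longlonglongrightarrow> 0"
    proof (rule Lim_null_comparison[OF _ n_inv[of "M / c"]])
      have "eventually (\<lambda>n. \<tau> n \<ge> 0) sequentially"
        using \<tau>_top by (simp add: filterlim_at_top)
      then show "\<forall>\<^sub>F n in sequentially. norm ((S n - W (\<tau> n)) / (c * real n)) \<le> M / c / real n"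
      proof eventually_elim
        case (elim n)
        have "\<bar>S n - W (\<tau> n)\<bar> \<le> M"
          using close[OF elim, of n] l(2) by (simp add: \<tau>_def abs_minus_commute)
        then show ?case using l(4) by (simp add: divide_right_mono)
      qed
    qed
    have "(\<lambda>n. W (\<tau> n) / \<tau> n * (\<tau> n / (c * real n)) + (S n - W (\<tau> n)) / (c * real n))
        \<longlonglongrightarrow> v * 1 + 0"
      by (intro tendsto_add tendsto_mult 1 2 3)
    moreover have "eventually (\<lambda>n. W (\<tau> n) / \<tau> n * (\<tau> n / (c * real n)) +
        (S n - W (\<tau> n)) / (c * real n) = S n / (c * real n)) sequentially"
      using filterlim_at_top_dense[THEN iffD1, OF \<tau>_top, rule_format, of 0]
      by eventually_elim (simp add: diff_divide_distrib)
    ultimately show "(\<lambda>n. S n / (c * real n)) \<longlonglongrightarrow> v"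
      by (simp add: tendsto_cong)
  next
    assume S: "(\<lambda>n. S n / (c * real n)) \<longlonglongrightarrow> v"
    \<comment> \<open>The predecessor of the first index with \<open>l\<close> beyond
      \<open>\<tau> - \<kappa>\<close> works. That first index exists since \<open>l\<close> is
      unbounded, and it is not 0 since \<open>l 0 = 0\<close>.\<close>
    have "\<exists>n. l n \<le> \<tau> - \<kappa> \<and> \<tau> - \<kappa> \<le> l (Suc n)" if "\<tau> \<ge> \<kappa>" for \<tau>
    proof -
      obtain m where m: "\<tau> - \<kappa> < l m"
        using filterlim_at_top_dense[THEN iffD1, OF l_top, rule_format, of "\<tau> - \<kappa>"]
        by (auto simp: eventually_sequentially)
      define m' where "m' = (LEAST m. \<tau> - \<kappa> < l m)"
      have m': "\<tau> - \<kappa> < l m'" unfolding m'_def using m by (rule LeastI)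
      then have "m' \<noteq> 0" using that l(1) by (intro notI) simp
      then obtain n where n: "m' = Suc n" using not0_implies_Suc by blast
      then have "\<not> \<tau> - \<kappa> < l n"
        using not_less_Least[of n "\<lambda>m. \<tau> - \<kappa> < l m"] by (simp add: m'_def)
      then show ?thesis using m' n by (auto intro!: exI[of _ n])
    qed
    then obtain N where N: "\<And>\<tau>. \<tau> \<ge> \<kappa> \<Longrightarrow> l (N \<tau>) \<le> \<tau> - \<kappa> \<and> \<tau> - \<kappa> \<le> l (Suc (N \<tau>))"
      by metis
    have N_top: "filterlim N at_top at_top"
      unfolding filterlim_at_top
    proof
      fix m
      show "\<forall>\<^sub>F \<tau> in at_top. m \<le> N \<tau>"
        using eventually_ge_at_top[of \<kappa>] eventually_gt_at_top[of "l m + \<kappa>"]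
      proof eventually_elim
        case (elim \<tau>)
        show ?case
        proof (rule ccontr)
          assume "\<not> m \<le> N \<tau>"
          then have "l (Suc (N \<tau>)) \<le> l m" by (intro mono) auto
          with N[of \<tau>] elim show False by linarith
        qed
      qed
    qed
    have 1: "((\<lambda>\<tau>. S (N \<tau>) / (c * real (N \<tau>))) \<longlongrightarrow> v) at_top"
      using filterlim_compose[OF S N_top] .
    \<comment> \<open>The quotient \<open>\<tau> / N \<tau>\<close> is squeezed between
      \<open>(l N + \<kappa>) / N\<close> and \<open>(l (Suc N) + \<kappa>) / N\<close>. The upper
      bound is rewritten so that the known limit of \<open>l n / real n\<close> applies at
      \<open>Suc n\<close>.\<close>
    have "(\<lambda>n. l (Suc n) / real (Suc n) * (1 + 1 / real n) + \<kappa> / real n) \<longlonglongrightarrow> c * (1 + 0) + 0"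
      using l(3) by (intro tendsto_intros n_inv LIMSEQ_Suc[of "\<lambda>n. l n / real n"])
    then have up: "(\<lambda>n. l (Suc n) / real (Suc n) * (1 + 1 / real n) + \<kappa> / real n) \<longlonglongrightarrow> c"
      by simp
    have "(\<lambda>n. l n / real n + \<kappa> / real n) \<longlonglongrightarrow> c + 0"
      by (intro tendsto_add l n_inv)
    then have lo: "(\<lambda>n. l n / real n + \<kappa> / real n) \<longlonglongrightarrow> c" by simp
    have N_pos: "eventually (\<lambda>\<tau>. 0 < N \<tau>) at_top"
      using N_top by (rule eventually_compose_filterlim[OF eventually_gt_at_top[of 0]])
    have "((\<lambda>\<tau>. \<tau> / real (N \<tau>)) \<longlongrightarrow> c) at_top"
    proof (rule tendsto_sandwich[OF _ _ filterlim_compose[OF lo N_top] filterlim_compose[OF up N_top]])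
      show "\<forall>\<^sub>F \<tau> in at_top. l (N \<tau>) / real (N \<tau>) + \<kappa> / real (N \<tau>) \<le> \<tau> / real (N \<tau>)"
        using eventually_ge_at_top[of \<kappa>] N_pos
      proof eventually_elim
        case (elim \<tau>)
        then show ?case using N[of \<tau>] by (simp add: add_divide_distrib[symmetric] divide_right_mono)
      qed
      show "\<forall>\<^sub>F \<tau> in at_top. \<tau> / real (N \<tau>) \<le>
          l (Suc (N \<tau>)) / real (Suc (N \<tau>)) * (1 + 1 / real (N \<tau>)) + \<kappa> / real (N \<tau>)"
        using eventually_ge_at_top[of \<kappa>] N_pos
      proof eventually_elim
        case (elim \<tau>)
        then have "l (Suc (N \<tau>)) / real (Suc (N \<tau>)) * (1 + 1 / real (N \<tau>)) =
            l (Suc (N \<tau>)) / real (N \<tau>)"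
          by (simp add: divide_simps)
        then show ?case using N[of \<tau>] elim
          by (simp add: add_divide_distrib[symmetric] divide_right_mono)
      qed
    qed
    then have "((\<lambda>\<tau>. c / (\<tau> / real (N \<tau>))) \<longlongrightarrow> c / c) at_top"
      using l(4) by (intro tendsto_divide tendsto_const) auto
    then have 2: "((\<lambda>\<tau>. c * real (N \<tau>) / \<tau>) \<longlongrightarrow> 1) at_top"
      using l(4) by simp
    have 3: "((\<lambda>\<tau>. (W \<tau> - S (N \<tau>)) / \<tau>) \<longlongrightarrow> 0) at_top"
    proof (rule Lim_null_comparison)
      show "((\<lambda>\<tau>. M / \<tau>) \<longlongrightarrow> 0) at_top"
        by (rule real_tendsto_divide_at_top[OF tendsto_const filterlim_ident])
      show "\<forall>\<^sub>F \<tau> in at_top. norm ((W \<tau> - S (N \<tau>)) / \<tau>) \<le> M / \<tau>"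
        using eventually_ge_at_top[of \<kappa>] eventually_gt_at_top[of 0]
      proof eventually_elim
        case (elim \<tau>)
        then show ?case using close[of \<tau> "N \<tau>"] N[of \<tau>] by (simp add: divide_right_mono)
      qed
    qed
    have "((\<lambda>\<tau>. S (N \<tau>) / (c * real (N \<tau>)) * (c * real (N \<tau>) / \<tau>) + (W \<tau> - S (N \<tau>)) / \<tau>)
        \<longlongrightarrow> v * 1 + 0) at_top"
      by (intro tendsto_add tendsto_mult 1 2 3)
    moreover have "\<forall>\<^sub>F \<tau> in at_top. S (N \<tau>) / (c * real (N \<tau>)) * (c * real (N \<tau>) / \<tau>) +
        (W \<tau> - S (N \<tau>)) / \<tau> = W \<tau> / \<tau>"
      using N_pos by eventually_elim (use l(4) in \<open>simp add: diff_divide_distrib\<close>)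
    ultimately show "((\<lambda>\<tau>. W \<tau> / \<tau>) \<longlongrightarrow> v) at_top"
      by (simp add: tendsto_cong)
  qed
qed

section \<open>Horoballs\<close>

text \<open>Kept holomorphic for either sign of the determinant: classes of determinant -1 act by
  applying it to \<open>cnj z\<close>.\<close>

definition moebius_map :: "int^2^2 \<Rightarrow> complex \<Rightarrow> complex" where
  "moebius_map A z = (of_int (A$1$1) * z + of_int (A$1$2)) / (of_int (A$2$1) * z + of_int (A$2$2))"

text \<open>For coprime \<open>p\<close>, \<open>q\<close> this is \<open>Im (A\<^sup>-\<^sup>1 z)\<close> for every unimodular \<open>A\<close> with first column
  \<open>(p, q)\<close>; its superlevel sets are the horoballs at the cusp \<open>p/q\<close>.\<close>

definition horo_height :: "int \<Rightarrow> int \<Rightarrow> complex \<Rightarrow> real" where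
  "horo_height p q z = Im z / (cmod (of_int q * z - of_int p))\<^sup>2"

lemma open_upper_half_plane: "open upper_half_plane"
  by (simp add: upper_half_plane_def open_halfspace_Im_gt)

lemma convex_upper_half_plane: "convex upper_half_plane"
  by (simp add: upper_half_plane_def convex_halfspace_Im_gt)

lemma moebius_denominator_nonzero:
  fixes A :: "int^2^2"
  assumes "det A = 1 \<or> det A = - 1" "Im z \<noteq> 0"
  shows "of_int (A$2$1) * z + of_int (A$2$2) \<noteq> 0"
proof
  assume *: "of_int (A$2$1) * z + of_int (A$2$2) = 0"
  from arg_cong[OF *, of Im] have "A$2$1 = 0" using assms by simp
  with * have "A$2$2 = 0" by simp
  with \<open>A$2$1 = 0\<close> assms show False by (simp add: det_2)
qed

lemma Im_moebius:
  fixes A :: "int^2^2"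
  shows "Im (moebius_map A z) = of_int (det A) * Im z / (cmod (of_int (A$2$1) * z + of_int (A$2$2)))\<^sup>2"
  unfolding moebius_map_def Im_divide det_2 cmod_power2 by (simp add: algebra_simps)

text \<open>Up to sign, the linear form \<open>q z - p\<close> is divided by the denominator
  \<open>D\<close> of the map, and the imaginary part by the square of its modulus, so
  \<open>D\<close> cancels.\<close>

lemma horo_height_moebius:
  fixes A :: "int^2^2"
  assumes "det A = 1 \<or> det A = - 1" "Im z \<noteq> 0"
  shows "horo_height (A$1$1 * p + A$1$2 * q) (A$2$1 * p + A$2$2 * q) (moebius_map A z) =
    of_int (det A) * horo_height p q z"
proof -
  let ?D = "of_int (A$2$1) * z + of_int (A$2$2)"
  have D: "?D \<noteq> 0" by (rule moebius_denominator_nonzero[OF assms])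
  have "of_int (A$2$1 * p + A$2$2 * q) * moebius_map A z - of_int (A$1$1 * p + A$1$2 * q) =
      of_int (det A) * (of_int q * z - of_int p) / ?D"
    using D by (simp add: moebius_map_def det_2 field_simps)
  then have "cmod (of_int (A$2$1 * p + A$2$2 * q) * moebius_map A z - of_int (A$1$1 * p + A$1$2 * q)) =
      cmod (of_int q * z - of_int p) / cmod ?D"
    using assms(1) by (auto simp: norm_divide norm_mult)
  then show ?thesis
    using D by (simp add: horo_height_def Im_moebius power_divide)
qed

lemma moebius_mult:
  fixes A B :: "int^2^2"
  assumes "of_int (B$2$1) * z + of_int (B$2$2) \<noteq> (0 :: complex)"
  shows "moebius_map A (moebius_map B z) = moebius_map (A ** B) z"
proof -
  define N D where "N = of_int (B$1$1) * z + of_int (B$1$2)"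
    and "D = of_int (B$2$1) * z + of_int (B$2$2)"
  have D: "D \<noteq> 0" using assms by (simp add: D_def)
  have "x * (N / D) + y = (x * N + y * D) / D" for x y
    using D by (simp add: field_simps)
  then have "moebius_map A (moebius_map B z) =
      (of_int (A$1$1) * N + of_int (A$1$2) * D) / (of_int (A$2$1) * N + of_int (A$2$2) * D)"
    using D by (simp add: moebius_map_def flip: N_def D_def)
  also have "\<dots> = moebius_map (A ** B) z"
    by (simp add: moebius_map_def N_def D_def matrix_matrix_mult_def sum_2 algebra_simps)
  finally show ?thesis .
qed

lemma moebius_inverse:
  fixes A :: "int^2^2"
  assumes "det A = 1 \<or> det A = - 1" "Im z \<noteq> 0"
  shows "moebius_map A (moebius_map (GL2Z_inverse A) z) = z"
  using assms moebius_denominator_nonzero[of "GL2Z_inverse A" z]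
  by (subst moebius_mult) (auto simp: det_GL2Z_inverse GL2Z_inverse_right moebius_map_def mat_1_eq_mat2)

lemma moebius_in_upper_half_plane:
  assumes "det A = 1" "z \<in> upper_half_plane"
  shows "moebius_map A z \<in> upper_half_plane"
  using assms moebius_denominator_nonzero[of A z]
  by (simp add: upper_half_plane_def Im_moebius)

lemma moebius_cnj_in_upper_half_plane:
  assumes "det A = - 1" "z \<in> upper_half_plane"
  shows "moebius_map A (cnj z) \<in> upper_half_plane"
  using assms moebius_denominator_nonzero[of A "cnj z"]
  by (simp add: upper_half_plane_def Im_moebius)

lemma horo_height_cnj: "horo_height p q (cnj z) = - horo_height p q z"
proof -
  have "cmod (of_int q * cnj z - of_int p) = cmod (cnj (of_int q * z - of_int p))"
    by simp
  then show ?thesis unfolding complex_mod_cnj by (simp add: horo_height_def)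
qed

section \<open>Convergence to a cusp\<close>

text \<open>Shrinking horoballs serve as the neighbourhoods of the cusp. One notion of limit then
  covers vertical lines, semicircles and images under unimodular maps, and
  \<open>i\<infinity>\<close> needs no separate treatment.\<close>

definition cusp_filter :: "int \<Rightarrow> int \<Rightarrow> complex filter" where
  "cusp_filter p q = inf (filtercomap (horo_height p q) at_top) (principal upper_half_plane)"

lemma filterlim_cusp_filter:
  "filterlim \<gamma> (cusp_filter p q) F \<longleftrightarrow>
    filterlim (\<lambda>t. horo_height p q (\<gamma> t)) at_top F \<and> (\<forall>\<^sub>F t in F. \<gamma> t \<in> upper_half_plane)"
  by (simp add: cusp_filter_def filterlim_inf filterlim_filtercomap_iff filterlim_principal o_def)

lemma eventually_cusp_filter_upper_half_plane: "\<forall>\<^sub>F z in cusp_filter p q. z \<in> upper_half_plane"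
  and filterlim_horo_height: "filterlim (horo_height p q) at_top (cusp_filter p q)"
  using filterlim_cusp_filter[of "\<lambda>z. z" p q "cusp_filter p q"] by (simp_all add: filterlim_ident)

lemma unimodular_completion:
  assumes "coprime p q"
  obtains A :: "int^2^2" where "det A = 1" "A$1$1 = p" "A$2$1 = q"
proof -
  obtain u v where "u * p + v * q = 1"
    using bezout_int[of p q] assms by (auto simp: coprime_iff_gcd_eq_1)
  then show ?thesis by (intro that[of "mat2 p (- v) q u"]) (auto simp: algebra_simps)
qed

lemma horo_height_Infty_column:
  fixes A :: "int^2^2"
  assumes "det A = 1" "z \<in> upper_half_plane"
  shows "horo_height (A$1$1) (A$2$1) (moebius_map A z) = Im z"
  using horo_height_moebius[of A z 1 0] assms by (simp add: upper_half_plane_def horo_height_def)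

text \<open>A unimodular matrix with first column \<open>(p, q)\<close> carries the imaginary axis,
  traversed upwards, to a path into the cusp. This makes limits at cusps unique.\<close>

lemma cusp_filter_neq_bot:
  assumes "coprime p q"
  shows "cusp_filter p q \<noteq> bot"
proof
  assume bot: "cusp_filter p q = bot"
  obtain A :: "int^2^2" where A: "det A = 1" "A$1$1 = p" "A$2$1 = q"
    using unimodular_completion[OF assms] .
  have ev: "\<forall>\<^sub>F t in at_top. \<i> * of_real t \<in> upper_half_plane"
    using eventually_gt_at_top[of 0] by eventually_elim (simp add: upper_half_plane_def)
  have "filterlim (\<lambda>t. horo_height p q (moebius_map A (\<i> * of_real t))) at_top at_top"
    using filterlim_ident
  proof (rule filterlim_cong[THEN iffD1, OF refl refl, rotated])
    show "\<forall>\<^sub>F t in at_top. t = horo_height p q (moebius_map A (\<i> * of_real t))"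
      using ev by eventually_elim (simp add: horo_height_Infty_column[OF A(1)] flip: A(2,3))
  qed
  moreover have "\<forall>\<^sub>F t in at_top. moebius_map A (\<i> * of_real t) \<in> upper_half_plane"
    using ev by eventually_elim (rule moebius_in_upper_half_plane[OF A(1)])
  ultimately have "filterlim (\<lambda>t. moebius_map A (\<i> * of_real t)) (cusp_filter p q) at_top"
    by (simp add: filterlim_cusp_filter)
  then show False by (simp add: bot filterlim_def bot.extremum_unique filtermap_bot_iff)
qed

section \<open>Integrals whose primitive has only limits at the ends\<close>

text \<open>Extending \<open>g\<close> by its one-sided limits makes it continuous on the closed
  interval. This is what geodesics ending at cusps require.\<close>

lemma has_integral_open_primitive:
  fixes g :: "real \<Rightarrow> 'a::real_normed_vector"
  assumes "a < b" and L: "(g \<longlongrightarrow> L) (at_right a)" and R: "(g \<longlongrightarrow> R) (at_left b)"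
    and d: "\<And>t. a < t \<Longrightarrow> t < b \<Longrightarrow> (g has_vector_derivative g' t) (at t)"
  shows "(g' has_integral (R - L)) {a..b}"
proof -
  define h where "h t = (if t \<le> a then L else if t \<ge> b then R else g t)" for t
  have ev: "\<forall>\<^sub>F s in at_right a. h s = g s" "\<forall>\<^sub>F s in at_left b. h s = g s"
    using eventually_at_right_real[OF \<open>a < b\<close>] eventually_at_left_real[OF \<open>a < b\<close>]
    by (auto simp: h_def elim!: eventually_mono)
  have dh: "(h has_vector_derivative g' t) (at t)" if "a < t" "t < b" for t
    by (rule has_vector_derivative_transform_within_open[OF d[OF that], of "{a<..<b}"])
      (use that in \<open>auto simp: h_def\<close>)
  have "(g' has_integral (h b - h a)) {a..b}"
  proof (rule fundamental_theorem_of_calculus_interior)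
    show "continuous_on {a..b} h"
    proof (rule continuous_on_IccI)
      show "(h \<longlongrightarrow> h a) (at_right a)" "(h \<longlongrightarrow> h b) (at_left b)"
        using L R ev \<open>a < b\<close> by (simp_all add: tendsto_cong h_def)
      show "h \<midarrow>t\<rightarrow> h t" if "a < t" "t < b" for t
        using has_vector_derivative_continuous[OF dh[OF that]] by (simp add: isCont_def)
    qed fact
  qed (use dh \<open>a < b\<close> in auto)
  then show ?thesis using \<open>a < b\<close> by (simp add: h_def)
qed

lemma has_integral_open_primitive_atLeast:
  fixes g :: "real \<Rightarrow> 'a::banach"
  assumes L: "(g \<longlongrightarrow> L) (at_right a)" and R: "(g \<longlongrightarrow> R) at_top"
    and d: "\<And>t. a < t \<Longrightarrow> (g has_vector_derivative g' t) (at t)"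
  shows "(g' has_integral (R - L)) {a..}"
proof -
  have "\<exists>B>0. \<forall>u v. ball 0 B \<subseteq> cbox u v \<longrightarrow>
      (\<exists>z. ((\<lambda>t. if t \<in> {a..} then g' t else 0) has_integral z) (cbox u v) \<and> norm (z - (R - L)) < e)"
    if e: "e > 0" for e
  proof -
    obtain K where K: "\<And>t. t \<ge> K \<Longrightarrow> dist (g t) R < e"
      using tendstoD[OF R e] unfolding eventually_at_top_linorder by blast
    \<comment> \<open>A box containing the ball of radius \<open>B\<close> contains
      \<open>B - 1/2\<close> and its negative, hence starts before \<open>a\<close> and reaches
      beyond both \<open>a\<close> and \<open>K\<close>.\<close>
    define B where "B = max 1 (max (K + 1) (\<bar>a\<bar> + 1))"
    show ?thesis
    proof (intro exI[of _ B] conjI allI impI)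
      show "B > 0" by (simp add: B_def)
      fix u v :: real assume sub: "ball 0 B \<subseteq> cbox u v"
      have "(B - 1/2) \<in> cbox u v" "- (B - 1/2) \<in> cbox u v"
        using sub by (intro subsetD[OF sub]; simp add: B_def)+
      then have uv: "u < a" "a < v" "K \<le> v" by (auto simp: B_def)
      have "(g' has_integral (g v - L)) {a..v}"
      proof (rule has_integral_open_primitive[OF uv(2) L _ d])
        show "(g \<longlongrightarrow> g v) (at_left v)"
          using has_vector_derivative_continuous[OF d[OF uv(2)]]
          by (simp add: isCont_def filterlim_at_split)
      qed
      then have "((\<lambda>t. if t \<in> {a..} then g' t else 0) has_integral (g v - L)) {a..v}"
        by (rule has_integral_eq[rotated]) auto
      moreover have "((\<lambda>t. if t \<in> {a..} then g' t else 0) has_integral 0) {u..a}"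
        by (rule has_integral_spike_finite[of "{a}" _ _ "\<lambda>_. 0"]) auto
      ultimately have "((\<lambda>t. if t \<in> {a..} then g' t else 0) has_integral (0 + (g v - L))) {u..v}"
        using uv by (intro has_integral_combine[of u a v]) auto
      then show "\<exists>z. ((\<lambda>t. if t \<in> {a..} then g' t else 0) has_integral z) (cbox u v) \<and>
          norm (z - (R - L)) < e"
        using K[OF uv(3)] by (intro exI[of _ "g v - L"]) (auto simp: dist_norm)
    qed
  qed
  moreover have "{a..} \<noteq> cbox u v" for u v :: real
  proof
    assume "{a..} = cbox u v"
    then have "max a v + 1 \<in> cbox u v"
      by (metis atLeast_iff le_add_same_cancel1 max.cobounded1 order_trans zero_le_one)
    then show False using max.cobounded2[of v a] by auto
  qed
  ultimately show ?thesis by (subst has_integral_alt) auto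
qed

lemma coprime_unimodular_image:
  fixes C :: "int^2^2"
  assumes "det C = 1 \<or> det C = - 1" "coprime p q"
  shows "coprime (C$1$1 * p + C$1$2 * q) (C$2$1 * p + C$2$2 * q)"
proof (rule coprimeI)
  let ?p = "C$1$1 * p + C$1$2 * q" and ?q = "C$2$1 * p + C$2$2 * q"
  fix d assume d: "d dvd ?p" "d dvd ?q"
  have "C$2$2 * ?p - C$1$2 * ?q = det C * p" "C$1$1 * ?q - C$2$1 * ?p = det C * q"
    by (simp_all add: det_2 algebra_simps)
  with d have "d dvd det C * p" "d dvd det C * q"
    by (metis dvd_diff dvd_mult)+
  then have "d dvd p" "d dvd q" using assms(1) by auto
  then show "is_unit d" using assms(2) coprime_common_divisor by blast
qed

lemma filterlim_moebius_cusp_filter: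
  fixes C :: "int^2^2"
  assumes "det C = 1"
  shows "filterlim (moebius_map C)
    (cusp_filter (C$1$1 * p + C$1$2 * q) (C$2$1 * p + C$2$2 * q)) (cusp_filter p q)"
  unfolding filterlim_cusp_filter
proof
  show "\<forall>\<^sub>F z in cusp_filter p q. moebius_map C z \<in> upper_half_plane"
    using eventually_cusp_filter_upper_half_plane
    by eventually_elim (rule moebius_in_upper_half_plane[OF assms])
  show "LIM z cusp_filter p q. horo_height (C$1$1 * p + C$1$2 * q) (C$2$1 * p + C$2$2 * q)
      (moebius_map C z) :> at_top"
    using filterlim_horo_height
  proof (rule filterlim_cong[THEN iffD1, OF refl refl, rotated])
    show "\<forall>\<^sub>F z in cusp_filter p q. horo_height p q z =
        horo_height (C$1$1 * p + C$1$2 * q) (C$2$1 * p + C$2$2 * q) (moebius_map C z)"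
      using eventually_cusp_filter_upper_half_plane
      by eventually_elim (use assms in \<open>simp add: horo_height_moebius upper_half_plane_def\<close>)
  qed
qed

lemma filterlim_moebius_cnj_cusp_filter:
  fixes C :: "int^2^2"
  assumes "det C = - 1"
  shows "filterlim (\<lambda>z. moebius_map C (cnj z))
    (cusp_filter (C$1$1 * p + C$1$2 * q) (C$2$1 * p + C$2$2 * q)) (cusp_filter p q)"
  unfolding filterlim_cusp_filter
proof
  show "\<forall>\<^sub>F z in cusp_filter p q. moebius_map C (cnj z) \<in> upper_half_plane"
    using eventually_cusp_filter_upper_half_plane
    by eventually_elim (rule moebius_cnj_in_upper_half_plane[OF assms])
  show "LIM z cusp_filter p q. horo_height (C$1$1 * p + C$1$2 * q) (C$2$1 * p + C$2$2 * q)
      (moebius_map C (cnj z)) :> at_top"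
    using filterlim_horo_height
  proof (rule filterlim_cong[THEN iffD1, OF refl refl, rotated])
    show "\<forall>\<^sub>F z in cusp_filter p q. horo_height p q z =
        horo_height (C$1$1 * p + C$1$2 * q) (C$2$1 * p + C$2$2 * q) (moebius_map C (cnj z))"
      using eventually_cusp_filter_upper_half_plane
      by eventually_elim
        (use assms in \<open>simp add: horo_height_moebius horo_height_cnj upper_half_plane_def\<close>)
  qed
qed

section \<open>Primitives of holomorphic differentials\<close>

text \<open>One differential is treated at a time. Convexity of the half plane will supply the
  primitive.\<close>

locale modular_primitive =
  fixes G :: "(int^2^2) set set" and f \<Phi> :: "complex \<Rightarrow> complex"
  assumes G: "subgroup G PGL2Z" and index: "finite (lcosets\<^bsub>PGL2Z\<^esub> G)"
    and f: "f \<in> hol_differentials G"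
    and primitive: "\<And>z. z \<in> upper_half_plane \<Longrightarrow> (\<Phi> has_field_derivative f z) (at z)"
begin

section \<open>Transformation of the primitive and its expansion at the cusps\<close>

lemma primitive_moebius:
  assumes "det A = 1 \<or> det A = - 1" "Im z \<noteq> 0" "moebius_map A z \<in> upper_half_plane"
  shows "((\<lambda>z. \<Phi> (moebius_map A z)) has_field_derivative slash A f z) (at z)"
proof -
  let ?D = "of_int (A$2$1) * z + of_int (A$2$2)"
  have "?D \<noteq> 0" by (rule moebius_denominator_nonzero[OF assms(1,2)])
  then have "(moebius_map A has_field_derivative of_int (det A) / ?D\<^sup>2) (at z)"
    unfolding moebius_map_def
    by (auto intro!: derivative_eq_intros simp: det_2 field_simps power2_eq_square)
  from DERIV_chain2[OF primitive[OF assms(3)] this] show ?thesis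
    by (simp add: slash_def moebius_map_def)
qed

text \<open>Both functions are primitives of \<open>f\<close>, because \<open>f\<close> is
  invariant; the constant is a period of the differential.\<close>

lemma primitive_equivariant:
  assumes "pgl C \<in> G" "det C = 1"
  obtains \<kappa> where "\<And>z. z \<in> upper_half_plane \<Longrightarrow> \<Phi> (moebius_map C z) = \<Phi> z + \<kappa>"
proof -
  have "\<exists>\<kappa>. \<forall>z\<in>upper_half_plane. \<Phi> (moebius_map C z) - \<Phi> z = \<kappa>"
  proof (rule has_field_derivative_zero_constant[OF convex_upper_half_plane])
    fix z assume z: "z \<in> upper_half_plane"
    have "slash C f z = f z"
      using f z assms by (auto simp: hol_differentials_def)
    then have "((\<lambda>z. \<Phi> (moebius_map C z) - \<Phi> z) has_field_derivative f z - f z) (at z)"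
      using primitive_moebius[of C z] moebius_in_upper_half_plane[OF assms(2) z] assms z
      by (intro DERIV_diff primitive) (auto simp: upper_half_plane_def)
    then show "((\<lambda>z. \<Phi> (moebius_map C z) - \<Phi> z) has_field_derivative 0) (at z within upper_half_plane)"
      by (simp add: has_field_derivative_at_within)
  qed
  then show ?thesis using that by (metis add.commute diff_add_cancel)
qed

text \<open>Conjugating both the argument and the value of the transformed primitive gives a
  holomorphic function, again a primitive of \<open>f\<close>.\<close>

lemma primitive_anti_equivariant:
  assumes "pgl C \<in> G" "det C = - 1"
  obtains \<kappa> where "\<And>z. z \<in> upper_half_plane \<Longrightarrow> \<Phi> (moebius_map C (cnj z)) = cnj (\<Phi> z) + \<kappa>"
proof -
  have "\<exists>\<kappa>. \<forall>z\<in>upper_half_plane. cnj (\<Phi> (moebius_map C (cnj z))) - \<Phi> z = \<kappa>"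
  proof (rule has_field_derivative_zero_constant[OF convex_upper_half_plane])
    fix z assume z: "z \<in> upper_half_plane"
    have "slash C f (cnj z) = cnj (f z)"
      using f z assms by (auto simp: hol_differentials_def)
    then have "((\<lambda>z. \<Phi> (moebius_map C z)) has_field_derivative cnj (f z)) (at (cnj z))"
      using primitive_moebius[of C "cnj z"] moebius_cnj_in_upper_half_plane[OF assms(2) z] assms z
      by (auto simp: upper_half_plane_def)
    from has_field_derivative_cnj_cnj[OF this]
    have "((\<lambda>z. cnj (\<Phi> (moebius_map C (cnj z)))) has_field_derivative f z) (at z)"
      by (simp add: o_def)
    then have "((\<lambda>z. cnj (\<Phi> (moebius_map C (cnj z))) - \<Phi> z) has_field_derivative f z - f z) (at z)"
      by (intro DERIV_diff primitive z)
    then show "((\<lambda>z. cnj (\<Phi> (moebius_map C (cnj z))) - \<Phi> z) has_field_derivative 0)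
        (at z within upper_half_plane)"
      by (simp add: has_field_derivative_at_within)
  qed
  then obtain \<kappa> where \<kappa>: "\<And>z. z \<in> upper_half_plane \<Longrightarrow> cnj (\<Phi> (moebius_map C (cnj z))) = \<Phi> z + \<kappa>"
    by (metis add.commute diff_add_cancel)
  show ?thesis
  proof (rule that)
    fix z assume "z \<in> upper_half_plane"
    from arg_cong[OF \<kappa>[OF this], of cnj]
    show "\<Phi> (moebius_map C (cnj z)) = cnj (\<Phi> z) + cnj \<kappa>" by simp
  qed
qed

text \<open>In the local coordinate the differential is \<open>F(q) dq\<close> on the whole disc. A
  primitive of \<open>F\<close> there, pulled back, differs from the transformed \<Phi> by a
  constant.\<close>

lemma primitive_cusp_expansion:
  assumes "det A = 1"
  obtains \<Psi> h where "0 < h" "\<Psi> holomorphic_on ball 0 1"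
    "\<And>z. z \<in> upper_half_plane \<Longrightarrow>
      \<Phi> (moebius_map A z) = \<Psi> (exp (2 * of_real pi * \<i> * z / of_real h))"
proof -
  define h where "h = real (cusp_width G A)"
  obtain F where F: "F holomorphic_on ball 0 1"
    and slash: "\<And>z. z \<in> upper_half_plane \<Longrightarrow> slash A f z =
      F (exp (2 * of_real pi * \<i> * z / of_real h)) *
        (2 * of_real pi * \<i> / of_real h * exp (2 * of_real pi * \<i> * z / of_real h))"
    using f assms unfolding hol_differentials_def Let_def h_def by auto
  have deriv: "((\<lambda>z. \<Phi> (moebius_map A z)) has_field_derivative slash A f z) (at z)"
    if "z \<in> upper_half_plane" for z
    using that primitive_moebius[of A z] moebius_in_upper_half_plane[OF assms that] assms
    by (auto simp: upper_half_plane_def)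
  show ?thesis
  proof (cases "h = 0")
    case True
    \<comment> \<open>Junk case: division by \<open>0\<close> makes the differential vanish.\<close>
    have "\<exists>\<kappa>. \<forall>z\<in>upper_half_plane. \<Phi> (moebius_map A z) = \<kappa>"
      using deriv slash True
      by (intro has_field_derivative_zero_constant[OF convex_upper_half_plane])
        (auto simp: has_field_derivative_at_within)
    then obtain \<kappa> where "\<And>z. z \<in> upper_half_plane \<Longrightarrow> \<Phi> (moebius_map A z) = \<kappa>" by blast
    then show ?thesis using that[of 1 "\<lambda>_. \<kappa>"] by auto
  next
    case False
    then have h: "0 < h" by (simp add: h_def)
    define E where "E z = exp (2 * of_real pi * \<i> * z / of_real h)" for z
    have E: "E z \<in> ball 0 1" if "z \<in> upper_half_plane" for z
      using that h by (simp add: E_def upper_half_plane_def field_simps)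
    obtain \<Psi> where "\<And>q. q \<in> ball 0 1 \<Longrightarrow> (\<Psi> has_field_derivative F q) (at q within ball 0 1)"
      using holomorphic_convex_primitive'[OF convex_ball open_ball F] by blast
    then have \<Psi>: "(\<Psi> has_field_derivative F q) (at q)" if "q \<in> ball 0 1" for q
      using that by (metis at_within_open open_ball)
    have "\<exists>\<kappa>. \<forall>z\<in>upper_half_plane. \<Phi> (moebius_map A z) - \<Psi> (E z) = \<kappa>"
    proof (rule has_field_derivative_zero_constant[OF convex_upper_half_plane])
      fix z assume z: "z \<in> upper_half_plane"
      have "(E has_field_derivative 2 * of_real pi * \<i> / of_real h * E z) (at z)"
        unfolding E_def using h by (auto intro!: derivative_eq_intros)
      from DERIV_chain2[OF \<Psi>[OF E[OF z]] this]
      have "((\<lambda>z. \<Phi> (moebius_map A z) - \<Psi> (E z)) has_field_derivative slash A f z - slash A f z) (at z)"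
        by (intro DERIV_diff deriv[OF z]) (simp add: slash[OF z] E_def)
      then show "((\<lambda>z. \<Phi> (moebius_map A z) - \<Psi> (E z)) has_field_derivative 0) (at z within upper_half_plane)"
        by (simp add: has_field_derivative_at_within)
    qed
    then obtain \<kappa> where "\<And>z. z \<in> upper_half_plane \<Longrightarrow> \<Phi> (moebius_map A z) - \<Psi> (E z) = \<kappa>"
      by blast
    then have "\<Phi> (moebius_map A z) = \<Psi> (E z) + \<kappa>" if "z \<in> upper_half_plane" for z
      using that by (metis add.commute diff_add_cancel)
    moreover have "\<Psi> holomorphic_on ball 0 1"
      unfolding holomorphic_on_open[OF open_ball] using \<Psi> by blast
    then have "(\<lambda>q. \<Psi> q + \<kappa>) holomorphic_on ball 0 1"
      by (intro holomorphic_intros)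
    ultimately show ?thesis using that[OF h, of "\<lambda>q. \<Psi> q + \<kappa>"] by (simp add: E_def)
  qed
qed

section \<open>Values of the primitive at the cusps and bounds on horoballs\<close>

definition cusp_value :: "int \<Rightarrow> int \<Rightarrow> complex" where
  "cusp_value p q = Lim (cusp_filter p q) \<Phi>"

text \<open>A unimodular matrix moves the cusp to \<open>i\<infinity>\<close>, where the height
  becomes the imaginary part and the coordinate \<open>q\<close> has modulus
  \<open>exp (- 2 * pi * height / h)\<close>. So the limit is the value of \<Psi> at 0, and height
  at least 1/2 confines \<open>q\<close> to a compact disc inside the unit disc.\<close>

lemma cusp_value_horoball:
  assumes "coprime p q"
  shows tendsto_cusp_value: "(\<Phi> \<longlongrightarrow> cusp_value p q) (cusp_filter p q)"
    and "\<exists>M. \<forall>z\<in>upper_half_plane. 1/2 \<le> horo_height p q z \<longrightarrow> cmod (\<Phi> z - cusp_value p q) \<le> M"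
proof -
  obtain A :: "int^2^2" where A: "det A = 1" "A$1$1 = p" "A$2$1 = q"
    using unimodular_completion[OF assms] .
  obtain \<Psi> h where h: "0 < h" and \<Psi>: "\<Psi> holomorphic_on ball 0 1"
    and exp: "\<And>z. z \<in> upper_half_plane \<Longrightarrow>
      \<Phi> (moebius_map A z) = \<Psi> (exp (2 * of_real pi * \<i> * z / of_real h))"
    by (rule primitive_cusp_expansion[OF A(1)]) (rule that)
  define q' where "q' z = exp (2 * of_real pi * \<i> * moebius_map (GL2Z_inverse A) z / of_real h)" for z
  have \<Phi>: "\<Phi> z = \<Psi> (q' z)" and norm_q': "cmod (q' z) = exp (- 2 * pi * horo_height p q z / h)"
    if z: "z \<in> upper_half_plane" for z
  proof -
    define w where "w = moebius_map (GL2Z_inverse A) z"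
    have w: "w \<in> upper_half_plane" "moebius_map A w = z"
      using A z moebius_inverse[of A z]
        moebius_in_upper_half_plane[of "GL2Z_inverse A" z] det_GL2Z_inverse[of A]
      unfolding w_def by (simp_all add: upper_half_plane_def)
    show "\<Phi> z = \<Psi> (q' z)" using exp[OF w(1)] w(2) by (simp add: q'_def w_def)
    show "cmod (q' z) = exp (- 2 * pi * horo_height p q z / h)"
      using horo_height_Infty_column[OF A(1) w(1)] by (simp add: q'_def w(2) A flip: w_def)
  qed
  have cont: "isCont \<Psi> 0"
    using \<Psi> by (auto intro: continuous_on_interior holomorphic_on_imp_continuous_on)
  have "((\<lambda>z. exp (- 2 * pi * horo_height p q z / h)) \<longlongrightarrow> 0) (cusp_filter p q)"
  proof (rule filterlim_compose[OF _ filterlim_horo_height])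
    show "((\<lambda>t. exp (- 2 * pi * t / h)) \<longlongrightarrow> 0) at_top" using h by real_asymp
  qed
  then have "((\<lambda>z. cmod (q' z)) \<longlongrightarrow> 0) (cusp_filter p q)"
    by (rule Lim_transform_eventually)
      (auto intro: eventually_mono[OF eventually_cusp_filter_upper_half_plane] simp: norm_q')
  then have "(q' \<longlongrightarrow> 0) (cusp_filter p q)" by (rule tendsto_norm_zero_cancel)
  from isCont_tendsto_compose[OF cont this]
  have lim: "(\<Phi> \<longlongrightarrow> \<Psi> 0) (cusp_filter p q)"
    by (rule Lim_transform_eventually)
      (auto intro: eventually_mono[OF eventually_cusp_filter_upper_half_plane] simp: \<Phi>)
  then have "cusp_value p q = \<Psi> 0"
    unfolding cusp_value_def by (rule tendsto_Lim[OF cusp_filter_neq_bot[OF assms]])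
  then show "(\<Phi> \<longlongrightarrow> cusp_value p q) (cusp_filter p q)" using lim by simp
  define r where "r = exp (- pi / h)"
  have "r < 1" using h by (simp add: r_def)
  then have "compact (\<Psi> ` cball 0 r)"
    by (intro compact_continuous_image compact_cball
        continuous_on_subset[OF holomorphic_on_imp_continuous_on[OF \<Psi>]]) auto
  then obtain M where M: "\<And>w. w \<in> cball 0 r \<Longrightarrow> cmod (\<Psi> w) \<le> M"
    using compact_imp_bounded bounded_iff by (metis image_eqI)
  show "\<exists>M. \<forall>z\<in>upper_half_plane. 1/2 \<le> horo_height p q z \<longrightarrow> cmod (\<Phi> z - cusp_value p q) \<le> M"
  proof (intro exI[of _ "M + cmod (cusp_value p q)"] ballI impI)
    fix z assume z: "z \<in> upper_half_plane" "1/2 \<le> horo_height p q z"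
    then have "cmod (q' z) \<le> r"
      using h by (simp add: norm_q' r_def field_simps)
    then have "cmod (\<Phi> z) \<le> M" using M[of "q' z"] \<Phi>[OF z(1)] by simp
    then show "cmod (\<Phi> z - cusp_value p q) \<le> M + cmod (cusp_value p q)"
      using norm_triangle_ineq4[of "\<Phi> z" "cusp_value p q"] by linarith
  qed
qed

lemma cusp_value_moebius:
  fixes C :: "int^2^2"
  assumes C: "det C = 1" and pq: "coprime p q"
    and \<kappa>: "\<And>z. z \<in> upper_half_plane \<Longrightarrow> \<Phi> (moebius_map C z) = \<Phi> z + \<kappa>"
  shows "cusp_value (C$1$1 * p + C$1$2 * q) (C$2$1 * p + C$2$2 * q) = cusp_value p q + \<kappa>"
proof (rule tendsto_unique[OF cusp_filter_neq_bot[OF pq]])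
  show "((\<lambda>z. \<Phi> (moebius_map C z)) \<longlongrightarrow>
      cusp_value (C$1$1 * p + C$1$2 * q) (C$2$1 * p + C$2$2 * q)) (cusp_filter p q)"
    using C pq by (intro filterlim_compose[OF tendsto_cusp_value filterlim_moebius_cusp_filter]
        coprime_unimodular_image) auto
  have "((\<lambda>z. \<Phi> z + \<kappa>) \<longlongrightarrow> cusp_value p q + \<kappa>) (cusp_filter p q)"
    by (intro tendsto_add tendsto_const tendsto_cusp_value pq)
  then show "((\<lambda>z. \<Phi> (moebius_map C z)) \<longlongrightarrow> cusp_value p q + \<kappa>) (cusp_filter p q)"
    by (rule Lim_transform_eventually)
      (auto intro: eventually_mono[OF eventually_cusp_filter_upper_half_plane] simp: \<kappa>)
qed

lemma cusp_value_moebius_cnj: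
  fixes C :: "int^2^2"
  assumes C: "det C = - 1" and pq: "coprime p q"
    and \<kappa>: "\<And>z. z \<in> upper_half_plane \<Longrightarrow> \<Phi> (moebius_map C (cnj z)) = cnj (\<Phi> z) + \<kappa>"
  shows "cusp_value (C$1$1 * p + C$1$2 * q) (C$2$1 * p + C$2$2 * q) = cnj (cusp_value p q) + \<kappa>"
proof (rule tendsto_unique[OF cusp_filter_neq_bot[OF pq]])
  show "((\<lambda>z. \<Phi> (moebius_map C (cnj z))) \<longlongrightarrow>
      cusp_value (C$1$1 * p + C$1$2 * q) (C$2$1 * p + C$2$2 * q)) (cusp_filter p q)"
    using C pq by (intro filterlim_compose[OF tendsto_cusp_value filterlim_moebius_cnj_cusp_filter]
        coprime_unimodular_image) auto
  have "((\<lambda>z. cnj (\<Phi> z) + \<kappa>) \<longlongrightarrow> cnj (cusp_value p q) + \<kappa>) (cusp_filter p q)"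
    by (intro tendsto_add tendsto_const tendsto_cnj tendsto_cusp_value pq)
  then show "((\<lambda>z. \<Phi> (moebius_map C (cnj z))) \<longlongrightarrow> cnj (cusp_value p q) + \<kappa>) (cusp_filter p q)"
    by (rule Lim_transform_eventually)
      (auto intro: eventually_mono[OF eventually_cusp_filter_upper_half_plane] simp: \<kappa>)
qed

text \<open>The additive constant cancels in the difference; for determinant -1 a conjugation
  remains, which the real part removes. Hence the representative of a coset does not affect its
  symbol.\<close>

lemma Re_cusp_value_diff_invariant:
  fixes C :: "int^2^2"
  assumes C: "pgl C \<in> G" "det C = 1 \<or> det C = - 1" and "coprime p q" "coprime p' q'"
  shows "Re (cusp_value (C$1$1 * p' + C$1$2 * q') (C$2$1 * p' + C$2$2 * q') -
      cusp_value (C$1$1 * p + C$1$2 * q) (C$2$1 * p + C$2$2 * q)) =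
    Re (cusp_value p' q' - cusp_value p q)"
  using C(2)
proof
  assume det: "det C = 1"
  obtain \<kappa> where "\<And>z. z \<in> upper_half_plane \<Longrightarrow> \<Phi> (moebius_map C z) = \<Phi> z + \<kappa>"
    by (rule primitive_equivariant[OF C(1) det]) (rule that)
  from cusp_value_moebius[OF det _ this] show ?thesis using assms by simp
next
  assume det: "det C = - 1"
  obtain \<kappa> where "\<And>z. z \<in> upper_half_plane \<Longrightarrow> \<Phi> (moebius_map C (cnj z)) = cnj (\<Phi> z) + \<kappa>"
    by (rule primitive_anti_equivariant[OF C(1) det]) (rule that)
  from cusp_value_moebius_cnj[OF det _ this] show ?thesis using assms by simp
qed

text \<open>\<Phi> and its value at the cusp change by the same constant, and heights are
  preserved.\<close>

lemma horoball_bound_transfer: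
  fixes C :: "int^2^2"
  assumes C: "pgl C \<in> G" "det C = 1" and pq: "coprime p q"
    and M: "\<And>z. z \<in> upper_half_plane \<Longrightarrow>
      1/2 \<le> horo_height (C$1$1 * p + C$1$2 * q) (C$2$1 * p + C$2$2 * q) z \<Longrightarrow>
      cmod (\<Phi> z - cusp_value (C$1$1 * p + C$1$2 * q) (C$2$1 * p + C$2$2 * q)) \<le> M"
    and z: "z \<in> upper_half_plane" "1/2 \<le> horo_height p q z"
  shows "cmod (\<Phi> z - cusp_value p q) \<le> M"
proof -
  obtain \<kappa> where \<kappa>: "\<And>z. z \<in> upper_half_plane \<Longrightarrow> \<Phi> (moebius_map C z) = \<Phi> z + \<kappa>"
    by (rule primitive_equivariant[OF C]) (rule that)
  have "1/2 \<le> horo_height (C$1$1 * p + C$1$2 * q) (C$2$1 * p + C$2$2 * q) (moebius_map C z)"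
    using z C by (simp add: horo_height_moebius upper_half_plane_def)
  from M[OF moebius_in_upper_half_plane[OF C(2) z(1)] this] show ?thesis
    by (simp add: \<kappa>[OF z(1)] cusp_value_moebius[OF C(2) pq \<kappa>])
qed

text \<open>Let \<open>A\<close> be unimodular with first column \<open>(p, q)\<close>. If the
  inverses of two such matrices lie in the same coset of \<open>G\<close>, an element of
  \<open>G\<close> carries one cusp to the other and the bound with it. So one bound per coset
  suffices, and there are finitely many cosets.\<close>

lemma uniform_horoball_bound:
  obtains M where "\<And>p q z. coprime p q \<Longrightarrow> z \<in> upper_half_plane \<Longrightarrow> 1/2 \<le> horo_height p q z \<Longrightarrow>
    cmod (\<Phi> z - cusp_value p q) \<le> M"
proof -
  interpret group PGL2Z by (rule group_PGL2Z)
  define bd where "bd M p q \<longleftrightarrow> (\<forall>z\<in>upper_half_plane. 1/2 \<le> horo_height p q z \<longrightarrow>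
    cmod (\<Phi> z - cusp_value p q) \<le> M)" for M p q
  have "\<exists>M. \<forall>A. det A = 1 \<and> pgl (GL2Z_inverse A) <#\<^bsub>PGL2Z\<^esub> G = s \<longrightarrow> bd M (A$1$1) (A$2$1)"
    for s
  proof (cases "\<exists>A. det A = 1 \<and> pgl (GL2Z_inverse A) <#\<^bsub>PGL2Z\<^esub> G = s")
    case True
    then obtain B where B: "det B = 1" "pgl (GL2Z_inverse B) <#\<^bsub>PGL2Z\<^esub> G = s" by blast
    have cop: "coprime (A$1$1) (A$2$1)" if "det A = 1" for A :: "int^2^2"
      using coprime_unimodular_image[of A 1 0] that by simp
    obtain M where M: "bd M (B$1$1) (B$2$1)"
      using cusp_value_horoball(2)[OF cop[OF B(1)]] unfolding bd_def by blast
    show ?thesis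
    proof (intro exI[of _ M] allI impI)
      fix A :: "int^2^2" assume A: "det A = 1 \<and> pgl (GL2Z_inverse A) <#\<^bsub>PGL2Z\<^esub> G = s"
      \<comment> \<open>It takes the cusp of \<open>A\<close> to that of \<open>B\<close>. As
        \<open>A\<close> and \<open>B\<close> have determinant 1, only the holomorphic
        transformation law is involved.\<close>
      let ?C = "B ** GL2Z_inverse A"
      have car: "pgl (GL2Z_inverse A) \<in> carrier PGL2Z" "pgl (GL2Z_inverse B) \<in> carrier PGL2Z"
        "pgl B \<in> carrier PGL2Z"
        using A B by (auto intro!: pgl_in_carrier simp: det_GL2Z_inverse)
      have "pgl (GL2Z_inverse A) \<in> pgl (GL2Z_inverse B) <#\<^bsub>PGL2Z\<^esub> G"
        using lcos_self[OF car(1) G] A B by simp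
      then obtain \<gamma> where \<gamma>: "\<gamma> \<in> G" "pgl (GL2Z_inverse A) = pgl (GL2Z_inverse B) \<otimes>\<^bsub>PGL2Z\<^esub> \<gamma>"
        by (auto simp: l_coset_def)
      have "\<gamma> \<in> carrier PGL2Z" using \<gamma>(1) G by (rule subgroup.mem_carrier[rotated])
      then have "pgl B \<otimes>\<^bsub>PGL2Z\<^esub> pgl (GL2Z_inverse A) = \<gamma>"
        using \<gamma> car B by (simp add: inv_solve_left' flip: inv_pgl m_assoc)
      then have "pgl ?C = \<gamma>"
        using A B pgl_mult[of B "GL2Z_inverse A"] by (simp add: det_GL2Z_inverse)
      then have C: "pgl ?C \<in> G" "det ?C = 1"
        using A B \<gamma>(1) by (simp_all add: det_GL2Z_inverse det_mul)
      have "?C ** A = B"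
        using A by (simp add: GL2Z_inverse_left flip: matrix_mul_assoc)
      then have "B$1$1 = ?C$1$1 * A$1$1 + ?C$1$2 * A$2$1" "B$2$1 = ?C$2$1 * A$1$1 + ?C$2$2 * A$2$1"
        by (metis (no_types, lifting) matrix_matrix_mult_def sum_2 vec_lambda_beta)+
      then show "bd M (A$1$1) (A$2$1)"
        using horoball_bound_transfer[OF C cop, of A M] A M unfolding bd_def by auto
    qed
  qed blast
  then obtain Mf where Mf: "\<And>s A. det A = 1 \<Longrightarrow> pgl (GL2Z_inverse A) <#\<^bsub>PGL2Z\<^esub> G = s \<Longrightarrow>
      bd (Mf s) (A$1$1) (A$2$1)"
    by metis
  show ?thesis
  proof (rule that[of "Max (Mf ` (lcosets\<^bsub>PGL2Z\<^esub> G))"])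
    fix p q z assume pq: "coprime p q" and z: "z \<in> upper_half_plane" "1/2 \<le> horo_height p q z"
    obtain A :: "int^2^2" where A: "det A = 1" "A$1$1 = p" "A$2$1 = q"
      using unimodular_completion[OF pq] .
    let ?s = "pgl (GL2Z_inverse A) <#\<^bsub>PGL2Z\<^esub> G"
    have "?s \<in> lcosets\<^bsub>PGL2Z\<^esub> G"
      using A by (auto simp: LCOSETS_def det_GL2Z_inverse intro!: bexI pgl_in_carrier)
    then have "Mf ?s \<le> Max (Mf ` (lcosets\<^bsub>PGL2Z\<^esub> G))" using index by simp
    moreover have "cmod (\<Phi> z - cusp_value p q) \<le> Mf ?s"
      using Mf[OF A(1) refl] A z by (auto simp: bd_def)
    ultimately show "cmod (\<Phi> z - cusp_value p q) \<le> Max (Mf ` (lcosets\<^bsub>PGL2Z\<^esub> G))" by linarith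
  qed
qed

section \<open>Integrals along geodesics between cusps\<close>

lemma primitive_along_path:
  assumes "\<gamma> t \<in> upper_half_plane" "(\<gamma> has_vector_derivative \<gamma>') (at t)"
  shows "((\<lambda>t. \<Phi> (\<gamma> t)) has_vector_derivative f (\<gamma> t) * \<gamma>') (at t)"
  using field_vector_diff_chain_at[OF assms(2) primitive[OF assms(1)]]
  by (simp add: o_def mult.commute)

text \<open>On this line the height at \<open>p/q\<close> is \<open>1 / (q\<^sup>2 * y)\<close> and
  the height at \<open>i\<infinity>\<close> is \<open>y\<close>, so both ends converge to their
  cusps. Here \<open>r\<close> is \<plusminus>1, since a matrix column may represent
  \<open>i\<infinity>\<close> with either sign.\<close>

lemma integral_vertical_geodesic:
  assumes "coprime p q" "q \<noteq> 0" "coprime r 0"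
  shows "integral {0..} (\<lambda>y. f (Complex (p / q) y) * \<i>) = cusp_value r 0 - cusp_value p q"
proof (rule integral_unique, rule has_integral_open_primitive_atLeast)
  have r: "of_int r * of_int r = (1 :: real)"
    using assms(3) by (auto simp: zmult_eq_1_iff abs_if split: if_splits)
  have Im: "\<forall>\<^sub>F y in at_right 0. Complex (p / q) y \<in> upper_half_plane"
    "\<forall>\<^sub>F y in at_top. Complex (p / q) y \<in> upper_half_plane"
    using eventually_at_right_less[of 0] eventually_gt_at_top[of 0]
    by (auto simp: upper_half_plane_def elim: eventually_mono)
  have "horo_height p q (Complex (p / q) y) = y / (q * y)\<^sup>2" for y :: real
    using assms(2) by (simp add: horo_height_def cmod_power2)
  moreover have "LIM y at_right (0::real). y / (q * y)\<^sup>2 :> at_top"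
  proof -
    have "0 < (real_of_int q)\<^sup>2" using assms(2) by simp
    then show ?thesis unfolding power_mult_distrib by real_asymp
  qed
  ultimately have "filterlim (\<lambda>y. Complex (p / q) y) (cusp_filter p q) (at_right 0)"
    using Im by (simp add: filterlim_cusp_filter)
  then show "((\<lambda>y. \<Phi> (Complex (p / q) y)) \<longlongrightarrow> cusp_value p q) (at_right 0)"
    by (rule filterlim_compose[OF tendsto_cusp_value[OF assms(1)]])
  have "horo_height r 0 (Complex (p / q) y) = y" for y
    using r by (simp add: horo_height_def power2_eq_square norm_mult[symmetric])
  then have "filterlim (\<lambda>y. Complex (p / q) y) (cusp_filter r 0) at_top"
    using Im by (simp add: filterlim_cusp_filter filterlim_ident)
  then show "((\<lambda>y. \<Phi> (Complex (p / q) y)) \<longlongrightarrow> cusp_value r 0) at_top"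
    by (rule filterlim_compose[OF tendsto_cusp_value[OF assms(3)]])
  fix y :: real assume "0 < y"
  moreover have "((\<lambda>y. Complex (p / q) y) has_vector_derivative \<i>) (at y)"
    unfolding Complex_eq by (auto intro!: derivative_eq_intros)
  ultimately show "((\<lambda>y. \<Phi> (Complex (p / q) y)) has_vector_derivative f (Complex (p / q) y) * \<i>) (at y)"
    by (intro primitive_along_path) (simp_all add: upper_half_plane_def)
qed

text \<open>Near its right end the height along the semicircle is a positive multiple of
  \<open>sin t / (1 - cos t)\<close>, which grows like \<open>1 / t\<close>; hence the arc enters
  every horoball at that cusp. In \<open>height\<close>, \<open>s\<close> tells the right end from
  the left one.\<close>

lemma integral_semicircle:
  assumes "coprime p q" "q \<noteq> 0" "coprime p' q'" "q' \<noteq> 0" and r: "0 < r"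
    and pq: "p / q = c + r" "p' / q' = c - (r :: real)"
  shows "contour_integral (part_circlepath (of_real c) r 0 pi) f = cusp_value p' q' - cusp_value p q"
proof -
  define \<gamma> where "\<gamma> t = of_real c + of_real r * cis t" for t
  have Re_Im: "Re (\<gamma> t) = c + r * cos t" "Im (\<gamma> t) = r * sin t" for t
    by (simp_all add: \<gamma>_def)
  have H: "\<gamma> t \<in> upper_half_plane" if "0 < t" "t < pi" for t
    using that r sin_gt_zero by (simp add: upper_half_plane_def Re_Im)
  have height: "horo_height P Q (\<gamma> t) = sin t / (2 * r * Q\<^sup>2 * (1 - s * cos t))"
    if "P / Q = c + s * r" "s = 1 \<or> s = - 1" "Q \<noteq> 0" for P Q :: int and s t
  proof -
    have P: "P = Q * (c + s * r)" using that by (simp add: field_simps)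
    have "(cmod (of_int Q * \<gamma> t - of_int P))\<^sup>2 = (Q * r)\<^sup>2 * ((cos t - s)\<^sup>2 + (sin t)\<^sup>2)"
    proof -
      have "Re (of_int Q * \<gamma> t - of_int P) = Q * r * (cos t - s)"
        "Im (of_int Q * \<gamma> t - of_int P) = Q * r * sin t"
        by (simp_all add: Re_Im P algebra_simps)
      then show ?thesis unfolding cmod_power2 by (simp only: power_mult_distrib distrib_left)
    qed
    also have "(cos t - s)\<^sup>2 + (sin t)\<^sup>2 = 2 * (1 - s * cos t)"
      using that(2) sin_cos_squared_add[of t] by (auto simp: power2_eq_square algebra_simps)
    finally show ?thesis
      using r that(3) by (simp add: horo_height_def Re_Im power2_eq_square)
  qed
  have lim: "LIM t at_right 0. sin t / (K * (1 - cos t)) :> at_top" if "0 < K" for K :: real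
    using that by real_asymp
  have "LIM t at_right 0. horo_height p q (\<gamma> t) :> at_top"
  proof -
    have "0 < 2 * r * (real_of_int q)\<^sup>2" using r assms(2) by simp
    from lim[OF this] show ?thesis using height[of p q 1] pq(1) assms(2) by simp
  qed
  moreover have "\<forall>\<^sub>F t in at_right 0. \<gamma> t \<in> upper_half_plane"
    using eventually_at_right_real[OF pi_gt_zero] by eventually_elim (simp add: H)
  ultimately have "filterlim \<gamma> (cusp_filter p q) (at_right 0)"
    by (simp add: filterlim_cusp_filter)
  from filterlim_compose[OF tendsto_cusp_value[OF assms(1)] this]
  have L: "((\<lambda>t. \<Phi> (\<gamma> t)) \<longlongrightarrow> cusp_value p q) (at_right 0)" .
  have "LIM t at_left pi. horo_height p' q' (\<gamma> t) :> at_top"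
  proof -
    have "0 < 2 * r * (real_of_int q')\<^sup>2" using r assms(4) by simp
    \<comment> \<open>The reflection of \<open>t\<close> to \<open>pi - t\<close> fixes the sine and
      negates the cosine, reducing the left end to the limit at the right end.\<close>
    have "LIM t at_left pi. pi - t :> at_right 0" by real_asymp
    from filterlim_compose[OF lim this, OF \<open>0 < 2 * r * (real_of_int q')\<^sup>2\<close>]
    show ?thesis using height[of p' q' "- 1"] pq(2) assms(4) by simp
  qed
  moreover have "\<forall>\<^sub>F t in at_left pi. \<gamma> t \<in> upper_half_plane"
    using eventually_at_left_real[OF pi_gt_zero] by eventually_elim (simp add: H)
  ultimately have "filterlim \<gamma> (cusp_filter p' q') (at_left pi)"
    by (simp add: filterlim_cusp_filter)
  from filterlim_compose[OF tendsto_cusp_value[OF assms(3)] this]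
  have R: "((\<lambda>t. \<Phi> (\<gamma> t)) \<longlongrightarrow> cusp_value p' q') (at_left pi)" .
  have "((\<lambda>t. f (\<gamma> t) * (of_real r * \<i> * cis t)) has_integral (cusp_value p' q' - cusp_value p q)) {0..pi}"
  proof (rule has_integral_open_primitive[OF pi_gt_zero L R])
    fix t assume t: "0 < t" "t < pi"
    have "(\<gamma> has_vector_derivative of_real r * \<i> * cis t) (at t)"
      unfolding \<gamma>_def cis_conv_exp
      by (rule has_vector_derivative_real_field) (auto intro!: derivative_eq_intros)
    then show "((\<lambda>t. \<Phi> (\<gamma> t)) has_vector_derivative f (\<gamma> t) * (of_real r * \<i> * cis t)) (at t)"
      by (rule primitive_along_path[where \<gamma> = \<gamma>, OF H[OF t]])
  qed
  then have "(f has_contour_integral (cusp_value p' q' - cusp_value p q))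
      (part_circlepath (of_real c) r 0 pi)"
    by (subst has_contour_integral_part_circlepath_iff) (simp_all add: \<gamma>_def mult.assoc)
  then show ?thesis by (rule contour_integral_unique)
qed

lemma geodesic_integral_cusps:
  assumes "coprime p q" "coprime p' q'" "p * q' \<noteq> p' * q"
  shows "geodesic_integral f (cusp_point p q) (cusp_point p' q') = cusp_value p' q' - cusp_value p q"
proof -
  have cplx: "complex_of_int a / complex_of_int b = of_real (a / b)" for a b :: int by simp
  consider "q = 0" "q' \<noteq> 0" | "q' = 0" "q \<noteq> 0" | "q \<noteq> 0" "q' \<noteq> 0"
    using assms(3) by fastforce
  then show ?thesis
  proof cases
    case 1
    then show ?thesis
      using integral_vertical_geodesic[OF assms(2), of p] assms
      unfolding cusp_point_def cplx by (simp del: of_real_divide of_real_of_int_eq)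
  next
    case 2
    then show ?thesis
      using integral_vertical_geodesic[OF assms(1), of p'] assms
      unfolding cusp_point_def cplx by (simp del: of_real_divide of_real_of_int_eq)
  next
    case 3
    define a b where "a = p / q" and "b = p' / q'"
    define c where "c = (a + b) / 2"
    have "a \<noteq> b"
    proof
      assume "a = b"
      then have "real_of_int (p * q') = real_of_int (p' * q)"
        using 3 by (simp add: a_def b_def field_simps)
      then show False using assms(3) by (simp only: of_int_eq_iff)
    qed
    then have arc: "geodesic_arc (of_real a) (of_real b) =
        part_circlepath (of_real c) \<bar>a - c\<bar> (Arg (of_real (a - c))) (Arg (of_real (b - c)))"
    proof -
      \<comment> \<open>For real end points the centre in \<open>geodesic_arc\<close> is their
        midpoint.\<close>
      have "(b\<^sup>2 - a\<^sup>2) / (2 * (b - a)) = c"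
        using \<open>a \<noteq> b\<close> by (simp add: c_def power2_eq_square field_simps)
      then show ?thesis
        using \<open>a \<noteq> b\<close> unfolding geodesic_arc_def Let_def
        by (simp flip: of_real_diff)
    qed
    have sym: "geodesic_integral f (cusp_point p q) (cusp_point p' q') =
        contour_integral (geodesic_arc (of_real a) (of_real b)) f"
      using 3 by (simp add: cusp_point_def a_def b_def)
    show ?thesis
    proof (cases "b < a")
      case True
      then have "a - c > 0" "b - c < 0" by (auto simp: c_def field_simps)
      then have "geodesic_arc (of_real a) (of_real b) = part_circlepath (of_real c) (a - c) 0 pi"
        by (simp add: arc Arg_of_real del: of_real_diff)
      moreover have "p / q = c + (a - c)" "p' / q' = c - (a - c)"
        by (simp_all add: c_def flip: a_def b_def)
      ultimately show ?thesis
        using integral_semicircle[OF assms(1) 3(1) assms(2) 3(2) \<open>a - c > 0\<close>] sym by simp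
    next
      case False
      then have neg: "a - c < 0" "b - c > 0" using \<open>a \<noteq> b\<close> by (auto simp: c_def field_simps)
      moreover have "\<bar>a - c\<bar> = b - c" using neg by (simp add: c_def field_simps)
      \<comment> \<open>From left to right the argument falls from \<open>pi\<close> to 0, so this
        is the previous semicircle reversed.\<close>
      ultimately have "geodesic_arc (of_real a) (of_real b) = part_circlepath (of_real c) (b - c) pi 0"
        using neg unfolding arc by (simp only: Arg_of_real) simp
      then have "geodesic_integral f (cusp_point p q) (cusp_point p' q') =
          - contour_integral (part_circlepath (of_real c) (b - c) 0 pi) f"
        using contour_integral_part_circlepath_reverse[of "of_real c" "b - c" pi 0 f] sym by simp
      moreover have "p' / q' = c + (b - c)" "p / q = c - (b - c)"
        by (simp_all add: c_def flip: a_def b_def)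
      ultimately show ?thesis
        using integral_semicircle[OF assms(2) 3(2) assms(1) 3(1) neg(2)] by simp
    qed
  qed
qed

end

section \<open>Limiting modular symbols\<close>

text \<open>On a vertical line the argument of \<open>arcosh\<close> is the hyperbolic cosine of the
  logarithm of the ratio of heights, so moving by \<tau> towards \<beta> scales the height by
  \<open>exp (- \<tau>)\<close>.\<close>

lemma geodesic_point_eq:
  assumes x0: "x0 \<in> vertical_geodesic \<beta>" and \<tau>: "0 \<le> \<tau>"
  shows "geodesic_point \<beta> x0 \<tau> = Complex \<beta> (Im x0 * exp (- \<tau>))"
proof -
  have y0: "0 < Im x0" "Re x0 = \<beta>" using x0 by (auto simp: vertical_geodesic_def)
  have dist: "hyp_dist x0 z = ln (Im x0 / Im z)"
    if z: "z \<in> vertical_geodesic \<beta>" "Im z \<le> Im x0" for z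
  proof -
    have y: "0 < Im z" "Re z = \<beta>" using z by (auto simp: vertical_geodesic_def)
    have "(cmod (x0 - z))\<^sup>2 = (Im x0 - Im z)\<^sup>2" using y0 y by (simp add: cmod_power2)
    then have "1 + (cmod (x0 - z))\<^sup>2 / (2 * Im x0 * Im z) = cosh (ln (Im x0 / Im z))"
      using y0 y by (simp add: cosh_ln_real field_simps power2_eq_square)
    moreover have "0 \<le> ln (Im x0 / Im z)" using y y0 z by simp
    ultimately show ?thesis by (simp add: hyp_dist_def arcosh_cosh_real)
  qed
  show ?thesis
    unfolding geodesic_point_def
  proof (rule the_equality)
    let ?z = "Complex \<beta> (Im x0 * exp (- \<tau>))"
    have "?z \<in> vertical_geodesic \<beta>" "Im ?z \<le> Im x0"
      using y0 \<tau> by (simp_all add: vertical_geodesic_def mult_left_le)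
    moreover have "hyp_dist x0 ?z = \<tau>"
      using dist[OF calculation] y0 by (simp add: exp_minus inverse_eq_divide)
    ultimately show "?z \<in> vertical_geodesic \<beta> \<and> hyp_dist x0 ?z = \<tau> \<and> Im ?z \<le> Im x0" by blast
  next
    fix z assume z: "z \<in> vertical_geodesic \<beta> \<and> hyp_dist x0 z = \<tau> \<and> Im z \<le> Im x0"
    then have "\<tau> = ln (Im x0 / Im z)" using dist by auto
    moreover have "0 < Im z" "Re z = \<beta>" using z by (auto simp: vertical_geodesic_def)
    ultimately show "z = Complex \<beta> (Im x0 * exp (- \<tau>))"
      using y0 by (simp add: complex_eq_iff exp_minus)
  qed
qed

text \<open>The denominator of the height is \<open>(Q * x - P)\<^sup>2 + (Q * y)\<^sup>2\<close>.
  The first square is \<open>\<delta>\<^sub>n\<^sub>+\<^sub>1\<^sup>2\<close>, at most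
  \<open>y\<close> by the lower bound on \<open>y\<close>; the second is at most \<open>y\<close>
  because \<open>y \<le> \<delta>\<^sub>n\<^sup>2\<close> and
  \<open>\<delta>\<^sub>n * Q \<le> 1\<close>.\<close>

lemma horo_height_convergent:
  assumes x: "0 < x" "x < 1" "x \<notin> \<rat>"
    and y: "(gauss_product x (Suc n))\<^sup>2 \<le> y" "y \<le> (gauss_product x n)\<^sup>2"
  shows "1/2 \<le> horo_height (conv_num (partial_quotient x) (Suc n))
    (conv_den (partial_quotient x) (Suc n)) (Complex x y)"
proof -
  define P Q where "P = real_of_int (conv_num (partial_quotient x) (Suc n))"
    and "Q = real_of_int (conv_den (partial_quotient x) (Suc n))"
  have pos: "0 < gauss_product x k" for k by (rule gauss_product_pos[OF x])
  then have "0 < y" using y(1) by (meson less_le_trans zero_less_power)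
  have "(Q * x - P)\<^sup>2 = (gauss_product x (Suc n))\<^sup>2"
    using conv_error[OF x, of "Suc n"] by (simp add: P_def Q_def power_mult_distrib flip: power_mult)
  then have 1: "(Q * x - P)\<^sup>2 \<le> y" using y by simp
  have "0 \<le> Q" using conv_den_nonneg[OF x] by (simp add: Q_def)
  have "(Q * y)\<^sup>2 = Q\<^sup>2 * y * y" by (simp add: power2_eq_square)
  also have "\<dots> \<le> Q\<^sup>2 * (gauss_product x n)\<^sup>2 * y"
    using y \<open>0 < y\<close> by (intro mult_right_mono mult_left_mono) auto
  also have "\<dots> = (gauss_product x n * Q)\<^sup>2 * y" by (simp add: power_mult_distrib)
  also have "\<dots> \<le> 1\<^sup>2 * y"
    using gauss_product_mult_conv_den_le[OF x, of n] pos[of n] \<open>0 \<le> Q\<close> \<open>0 < y\<close>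
    by (intro mult_right_mono power_mono) (auto simp: Q_def)
  finally have 2: "(Q * y)\<^sup>2 \<le> y" by simp
  have "horo_height (conv_num (partial_quotient x) (Suc n))
      (conv_den (partial_quotient x) (Suc n)) (Complex x y) = y / ((Q * x - P)\<^sup>2 + (Q * y)\<^sup>2)"
    by (simp add: horo_height_def cmod_power2 P_def Q_def)
  moreover have "0 < (Q * x - P)\<^sup>2"
    using pos[of "Suc n"] \<open>(Q * x - P)\<^sup>2 = (gauss_product x (Suc n))\<^sup>2\<close> by simp
  then have "0 < (Q * x - P)\<^sup>2 + (Q * y)\<^sup>2" by (intro add_pos_nonneg) auto
  then have "1/2 \<le> y / ((Q * x - P)\<^sup>2 + (Q * y)\<^sup>2)"
    using 1 2 by (simp add: le_divide_eq)
  ultimately show ?thesis by simp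
qed

section \<open>The orbit sum against the integral along the geodesic\<close>

context modular_primitive
begin

text \<open>The orbit of the base point consists of the cosets of the inverses of
  \<open>g\<^sub>k\<close>. Unimodularity keeps the two cusps distinct, and the unknown element of
  \<open>G\<close> drops out by invariance.\<close>

lemma coset_symbol_convergents:
  "coset_symbol G (snd ((shift ^^ k) (x, base_point G))) f =
    Re (cusp_value (conv_num (partial_quotient x) (Suc k)) (conv_den (partial_quotient x) (Suc k)) -
      cusp_value (conv_num (partial_quotient x) k) (conv_den (partial_quotient x) k))"
proof -
  let ?B = "conv_mat (partial_quotient x) k"
  let ?P = "conv_num (partial_quotient x)" and ?Q = "conv_den (partial_quotient x)"
  obtain C where C: "det C = 1 \<or> det C = - 1" "pgl C \<in> G"
    "coset_symbol G (pgl (GL2Z_inverse ?B) <#\<^bsub>PGL2Z\<^esub> G) =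
      modular_symbol G (cusp_point ((C ** ?B)$1$1) ((C ** ?B)$2$1))
        (cusp_point ((C ** ?B)$1$2) ((C ** ?B)$2$2))"
    by (rule coset_symbol_coset[OF G det_conv_mat]) (rule that)
  define p q p' q' where "p = C$1$1 * ?P k + C$1$2 * ?Q k" "q = C$2$1 * ?P k + C$2$2 * ?Q k"
    "p' = C$1$1 * ?P (Suc k) + C$1$2 * ?Q (Suc k)" "q' = C$2$1 * ?P (Suc k) + C$2$2 * ?Q (Suc k)"
  note pq = this
  have entries: "(C ** ?B)$1$1 = p" "(C ** ?B)$2$1 = q" "(C ** ?B)$1$2 = p'" "(C ** ?B)$2$2 = q'"
    by (simp_all add: matrix_matrix_mult_def sum_2 conv_mat_def pq)
  have "det (C ** ?B) = 1 \<or> det (C ** ?B) = - 1"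
    using C(1) det_conv_mat[of "partial_quotient x" k] by (auto simp: det_mul)
  then have "p * q' \<noteq> p' * q" by (auto simp: det_2 entries)
  moreover have "coprime p q" "coprime p' q'"
    unfolding pq by (intro coprime_unimodular_image C coprime_conv)+
  ultimately have "coset_symbol G (snd ((shift ^^ k) (x, base_point G))) f =
      Re (cusp_value p' q' - cusp_value p q)"
    using f by (simp add: base_point_eq[OF G] shift_iterate[OF G] C(3) entries modular_symbol_def
        geodesic_integral_cusps)
  also have "\<dots> = Re (cusp_value (?P (Suc k)) (?Q (Suc k)) - cusp_value (?P k) (?Q k))"
    unfolding pq by (rule Re_cusp_value_diff_invariant[OF C(2,1) coprime_conv coprime_conv])
  finally show ?thesis .
qed

lemma modular_symbol_vertical:
  assumes "z \<in> vertical_geodesic \<beta>" "w \<in> vertical_geodesic \<beta>"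
  shows "modular_symbol G (Fin z) (Fin w) f = Re (\<Phi> w - \<Phi> z)"
proof -
  have "closed_segment z w \<subseteq> upper_half_plane"
    using assms by (intro closed_segment_subset convex_upper_half_plane)
      (auto simp: upper_half_plane_def vertical_geodesic_def)
  then have "(f has_contour_integral (\<Phi> w - \<Phi> z)) (linepath z w)"
    using contour_integral_primitive[of upper_half_plane \<Phi> f "linepath z w"] primitive
    by (simp add: has_field_derivative_at_within)
  moreover have "geodesic_arc z w = linepath z w"
    using assms by (simp add: geodesic_arc_def vertical_geodesic_def)
  ultimately show ?thesis
    using f by (simp add: modular_symbol_def contour_integral_unique)
qed

lemma limiting_symbol_iff:
  assumes \<beta>: "\<beta> \<in> lyapunov_level c" and x0: "x0 \<in> vertical_geodesic \<beta>"
  shows "((\<lambda>\<tau>. 1 / \<tau> * modular_symbol G (Fin x0) (Fin (geodesic_point \<beta> x0 \<tau>)) f) \<longlongrightarrow> l) at_top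
    \<longleftrightarrow> (\<lambda>n. 1 / (c * real n) *
       (\<Sum>k=1..n. coset_symbol G (snd ((shift ^^ k) (\<beta>, base_point G))) f)) \<longlonglongrightarrow> l"
proof -
  note \<beta>' = lyapunov_level_conv(1-3)[OF \<beta>]
  have y0: "0 < Im x0" using x0 by (simp add: vertical_geodesic_def)
  define \<Lambda> where "\<Lambda> n = cusp_value (conv_num (partial_quotient \<beta>) n) (conv_den (partial_quotient \<beta>) n)"
    for n
  \<comment> \<open>Chosen so that \<open>exp (- t n)\<close> is the height
    \<open>\<delta>\<^sub>n\<^sup>2\<close> at which the horoball of
    \<open>p\<^sub>n/q\<^sub>n\<close> is entered; starting at \<open>x0\<close> delays this by
    \<open>ln (Im x0)\<close>.\<close>
  define t where "t n = - 2 * ln (gauss_product \<beta> n)" for n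
  define W where "W \<tau> = Re (\<Phi> (Complex \<beta> (Im x0 * exp (- \<tau>))) - \<Phi> x0)" for \<tau>
  define S where "S n = Re (\<Lambda> (Suc n) - \<Lambda> 1)" for n
  have pos: "0 < gauss_product \<beta> n" for n by (rule gauss_product_pos[OF \<beta>'])
  have exp_t: "exp (- t n) = (gauss_product \<beta> n)\<^sup>2" for n
    using pos[of n] by (simp add: t_def exp_double)
  obtain M where M: "\<And>p q z. coprime p q \<Longrightarrow> z \<in> upper_half_plane \<Longrightarrow> 1/2 \<le> horo_height p q z \<Longrightarrow>
      cmod (\<Phi> z - cusp_value p q) \<le> M"
    by (rule uniform_horoball_bound) (rule that)
  \<comment> \<open>The bound \<open>M\<close> compares the moving ends; the other summand accounts
    for the different starting points, \<open>x0\<close> and the cusp 0.\<close>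
  have close: "\<bar>W \<tau> - S n\<bar> \<le> M + cmod (\<Lambda> 1 - \<Phi> x0)"
    if \<tau>: "t n \<le> \<tau> - ln (Im x0)" "\<tau> - ln (Im x0) \<le> t (Suc n)" for n \<tau>
  proof -
    define y where "y = Im x0 * exp (- \<tau>)"
    have y: "y = exp (- (\<tau> - ln (Im x0)))" using y0 by (simp add: y_def exp_diff exp_minus field_simps)
    have "exp (- t (Suc n)) \<le> y" "y \<le> exp (- t n)" unfolding y using \<tau> by auto
    then have "1/2 \<le> horo_height (conv_num (partial_quotient \<beta>) (Suc n))
        (conv_den (partial_quotient \<beta>) (Suc n)) (Complex \<beta> y)"
      unfolding exp_t by (rule horo_height_convergent[OF \<beta>'])
    then have "cmod (\<Phi> (Complex \<beta> y) - \<Lambda> (Suc n)) \<le> M"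
      unfolding \<Lambda>_def using y0 by (intro M coprime_conv) (simp_all add: upper_half_plane_def y_def)
    moreover have "W \<tau> - S n = Re ((\<Phi> (Complex \<beta> y) - \<Lambda> (Suc n)) + (\<Lambda> 1 - \<Phi> x0))"
      by (simp add: W_def S_def y_def)
    ultimately show ?thesis
      using abs_Re_le_cmod norm_triangle_ineq by (smt (verit))
  qed
  \<comment> \<open>Summation from 1 telescopes down to \<open>\<Lambda> 1\<close>, the value at the
    convergent 0/1, so the step leaving \<open>i\<infinity>\<close> is not part of the sum.\<close>
  have "(\<Sum>k=1..n. coset_symbol G (snd ((shift ^^ k) (\<beta>, base_point G))) f) = S n" for n
  proof -
    have "(\<Sum>k=1..n. Re (\<Lambda> (Suc k)) - Re (\<Lambda> k)) = Re (\<Lambda> (Suc n)) - Re (\<Lambda> 1)"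
      by (rule sum_Suc_diff) simp
    then show ?thesis by (simp add: coset_symbol_convergents S_def flip: \<Lambda>_def)
  qed
  moreover have "((\<lambda>\<tau>. 1 / \<tau> * modular_symbol G (Fin x0) (Fin (geodesic_point \<beta> x0 \<tau>)) f) \<longlongrightarrow> l) at_top
      \<longleftrightarrow> ((\<lambda>\<tau>. W \<tau> / \<tau>) \<longlongrightarrow> l) at_top"
  proof (rule tendsto_cong)
    show "\<forall>\<^sub>F \<tau> in at_top. 1 / \<tau> * modular_symbol G (Fin x0) (Fin (geodesic_point \<beta> x0 \<tau>)) f = W \<tau> / \<tau>"
      using eventually_ge_at_top[of 0]
    proof eventually_elim
      case (elim \<tau>)
      have "Complex \<beta> (Im x0 * exp (- \<tau>)) \<in> vertical_geodesic \<beta>"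
        using y0 by (simp add: vertical_geodesic_def)
      from modular_symbol_vertical[OF x0 this] show ?case
        by (simp add: geodesic_point_eq[OF x0 elim] W_def)
    qed
  qed
  moreover have "((\<lambda>\<tau>. W \<tau> / \<tau>) \<longlongrightarrow> l) at_top \<longleftrightarrow> (\<lambda>n. S n / (c * real n)) \<longlonglongrightarrow> l"
  proof (rule renewal_limit_iff[where l = t])
    show "t 0 = 0" by (simp add: t_def)
    show "t n \<le> t (Suc n)" for n
      using gauss_product_Suc_le[OF \<beta>', of n] pos by (simp add: t_def)
    show "(\<lambda>n. t n / real n) \<longlonglongrightarrow> c" "0 < c"
      using lyapunov_level_conv(4,5)[OF \<beta>] by (simp_all add: t_def)
    show "\<bar>W \<tau> - S n\<bar> \<le> M + cmod (\<Lambda> 1 - \<Phi> x0)"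
      if "0 \<le> \<tau>" "t n \<le> \<tau> - ln (Im x0)" "\<tau> - ln (Im x0) \<le> t (Suc n)" for n \<tau>
      using close that by blast
  qed
  ultimately show ?thesis by simp
qed

end

lemma tendsto_fun_iff:
  fixes F :: "'a \<Rightarrow> 'b \<Rightarrow> 'c::topological_space"
  shows "(F \<longlongrightarrow> v) net \<longleftrightarrow> (\<forall>i. ((\<lambda>x. F x i) \<longlongrightarrow> v i) net)"
  using limitin_componentwise[of "\<lambda>_. euclidean" UNIV F v net]
  by (simp add: euclidean_product_topology)

text \<open>The equivalence expresses that either limit exists when the other does, with the same
  value. The proof evaluates both at each differential separately.\<close>

theorem mainTheorem1:
  fixes G :: "(int^2^2) set set" and c \<beta> :: real and v :: homology_class
  assumes "subgroup G PGL2Z"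
    and "finite (lcosets\<^bsub>PGL2Z\<^esub> G)"
    and "\<beta> \<in> lyapunov_level c"
  shows "has_limiting_modular_symbol G \<beta> v \<longleftrightarrow>
    (\<lambda>n \<omega>. 1 / (c * real n) *
       (\<Sum>k=1..n. coset_symbol G (snd ((shift ^^ k) (\<beta>, base_point G))) \<omega>)) \<longlonglongrightarrow> v"
proof -
  have pointwise: "((\<lambda>\<tau>. 1 / \<tau> * modular_symbol G (Fin x0) (Fin (geodesic_point \<beta> x0 \<tau>)) \<omega>) \<longlongrightarrow> v \<omega>) at_top
    \<longleftrightarrow> (\<lambda>n. 1 / (c * real n) *
       (\<Sum>k=1..n. coset_symbol G (snd ((shift ^^ k) (\<beta>, base_point G))) \<omega>)) \<longlonglongrightarrow> v \<omega>"
    if x0: "x0 \<in> vertical_geodesic \<beta>" for x0 \<omega>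
  proof (cases "\<omega> \<in> hol_differentials G")
    case True
    then have "\<omega> holomorphic_on upper_half_plane" by (simp add: hol_differentials_def)
    from holomorphic_convex_primitive'[OF convex_upper_half_plane open_upper_half_plane this]
    obtain \<Phi> where "\<And>z. z \<in> upper_half_plane \<Longrightarrow>
        (\<Phi> has_field_derivative \<omega> z) (at z within upper_half_plane)" by blast
    then have "(\<Phi> has_field_derivative \<omega> z) (at z)" if "z \<in> upper_half_plane" for z
      using that by (simp add: at_within_open[OF _ open_upper_half_plane])
    then interpret modular_primitive G \<omega> \<Phi>
      by (rule modular_primitive.intro[OF assms(1,2) True])
    show ?thesis by (rule limiting_symbol_iff[OF assms(3) x0])
  next
    case False
    \<comment> \<open>Off the differentials all symbols are extended by 0, so both sides say that
      \<open>v \<omega>\<close> is 0.\<close>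
    then have "modular_symbol G a b \<omega> = 0" "coset_symbol G s \<omega> = 0" for a b s
      by (simp_all add: modular_symbol_def coset_symbol_def Let_def)
    then show ?thesis by (simp add: tendsto_const_iff)
  qed
  \<comment> \<open>The limiting symbol quantifies over all base points; having one keeps that
    condition from being vacuous.\<close>
  have "Complex \<beta> 1 \<in> vertical_geodesic \<beta>" by (simp add: vertical_geodesic_def)
  then show ?thesis
    unfolding has_limiting_modular_symbol_def tendsto_fun_iff using pointwise by blast
qed

end
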